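(* Let $n\ge1$, let $f\in VMO(\mathbb{R}^n)$, and suppose that $Mf$ is not identically equal to $+\infty$. Then $Mf\in VMO(\mathbb{R}^n)$.
   Context: A cube is a closed cube in $\mathbb{R}^n$ with sides parallel to the axes, and $l(Q)$ denotes the side length of the cube $Q$. For $f\in L^1_{loc}(\mathbb{R}^n)$ and a measurable set $A$ of positive finite measure, $f_A=\frac{1}{|A|}\int_A f$ and $O(f,A)=\frac{1}{|A|}\int_A|f-f_A|$. $BMO(\mathbb{R}^n)$ is the space of $f\in L^1_{loc}(\mathbb{R}^n)$ with $\|f\|_{BMO(\mathbb{R}^n)}=\sup_Q O(f,Q)<\infty$, the supremum over all cubes $Q$. $VMO(\mathbb{R}^n)$ is the closure in $BMO(\mathbb{R}^n)$ of the uniformly continuous functions belonging to $BMO(\mathbb{R}^n)$; equivalently, $f\in BMO(\mathbb{R}^n)$ belongs to $VMO(\mathbb{R}^n)$ exactly when $\lim_{\delta\to0}\omega(f,\delta)=0$, where $\omega(f,\delta)=\sup_{l(Q)\le\delta}O(f,Q)$. $M$ is the uncentered Hardy-Littlewood maximal operator: $Mf(x)=\sup_{Q\ni x}\frac{1}{|Q|}\int_Q|f|$, the supremum over all cubes $Q$ containing $x$. *)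

theory Defs
  imports "HOL-Analysis.Analysis"
begin

definition cubes :: "(real ^ 'n) set set" where
  "cubes = {cbox a (\<chi> i. a $ i + l) | a l. l > 0}"

definition L1_loc :: "(real ^ 'n \<Rightarrow> real) set" where
  "L1_loc = {f. \<forall>K. compact K \<longrightarrow> set_integrable lebesgue K f}"

definition avg :: "(real ^ 'n \<Rightarrow> real) \<Rightarrow> (real ^ 'n) set \<Rightarrow> real" where
  "avg f A = (LINT y:A|lebesgue. f y) / measure lebesgue A"

definition mean_osc :: "(real ^ 'n \<Rightarrow> real) \<Rightarrow> (real ^ 'n) set \<Rightarrow> real" where
  "mean_osc f A = (LINT y:A|lebesgue. \<bar>f y - avg f A\<bar>) / measure lebesgue A"

text \<open>Meaningful only for locally integrable \<open>f\<close>, since a Bochner integral is 0 where it does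
  not exist. It is a seminorm: functions are not identified modulo constants.\<close>

definition bmo_norm :: "(real ^ 'n \<Rightarrow> real) \<Rightarrow> ennreal" where
  "bmo_norm f = (SUP Q\<in>cubes. ennreal (mean_osc f Q))"

definition BMO :: "(real ^ 'n \<Rightarrow> real) set" where
  "BMO = {f \<in> L1_loc. bmo_norm f < \<infinity>}"

text \<open>The closure, for the seminorm of \<open>BMO\<close>, of the uniformly continuous functions in \<open>BMO\<close>.\<close>

definition VMO :: "(real ^ 'n \<Rightarrow> real) set" where
  "VMO = {f \<in> BMO. \<forall>\<epsilon>>0. \<exists>g\<in>BMO. uniformly_continuous_on UNIV g \<and>
            bmo_norm (\<lambda>x. f x - g x) < ennreal \<epsilon>}"

text \<open>The maximal function is extended-valued: even for \<open>f\<close> in \<open>VMO\<close> it may be infinite on a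
  nonempty null set.\<close>

definition maximal :: "(real ^ 'n \<Rightarrow> real) \<Rightarrow> real ^ 'n \<Rightarrow> ennreal" where
  "maximal f x = (SUP Q\<in>{Q \<in> cubes. x \<in> Q}.
     (\<integral>\<^sup>+y\<in>Q. ennreal \<bar>f y\<bar> \<partial>lebesgue) / emeasure lebesgue Q)"

end

theory Submission
  imports Defs
begin

text \<open>
  Write \<open>F = \<bar>f\<bar>\<close>, which is again in \<open>VMO\<close>, and suppose that \<open>F = g + h\<close> with \<open>g\<close> continuous and
  \<open>h\<close> of mean oscillation at most \<open>B\<close> on every cube. Let \<open>Q\<close> be a cube of side \<open>l\<close> such that \<open>g\<close> varies
  by at most \<open>\<eta>\<close> between points whose coordinates differ by at most \<open>6 l\<close>. The heart of the proof is
  the bound, for every \<open>y\<close> in \<open>Q\<close>,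
  \<open>\<integral>\<^sub>Q M f \<le> l\<^sup>n (M f y + \<eta> + K B)\<close> with \<open>K\<close> depending only on the dimension \<open>n\<close>
  (\<open>integral_maximal_le\<close>). It says that the mean of \<open>M f\<close> over \<open>Q\<close> exceeds the infimum of \<open>M f\<close> over
  \<open>Q\<close> by at most \<open>\<eta> + K B\<close>, so \<open>M f\<close> is finite almost everywhere as soon as it is finite somewhere,
  and its oscillation on \<open>Q\<close> is at most a multiple of \<open>\<eta> + K B\<close>. With \<open>g = 0\<close> and \<open>h = F\<close> this gives
  \<open>M f \<in> BMO\<close>. With \<open>g\<close> a uniformly continuous approximation of \<open>F\<close> in \<open>BMO\<close>, both \<open>B\<close> and, for
  small \<open>l\<close>, also \<open>\<eta>\<close> are as small as desired, so the oscillation of \<open>M f\<close> on small cubes tends to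
  zero. By Sarason's theorem (\<open>VMO_I\<close>) this puts \<open>M f\<close> into the closure of the uniformly continuous
  functions; the uniformly continuous approximation is a mollification.

  To prove the bound, let \<open>R\<close> be a cube containing a point \<open>x\<close> of \<open>Q\<close>. If the side of \<open>R\<close> is at least
  \<open>l\<close>, translate \<open>R\<close> by \<open>y - x\<close>: the new cube contains \<open>y\<close>, the mean of \<open>g\<close> moves by at most \<open>\<eta>\<close>, and
  the mean of \<open>h\<close> moves by at most a multiple of \<open>B\<close>, because both cubes lie in one of twice the side.
  If the side of \<open>R\<close> is less than \<open>l\<close>, then \<open>R\<close> lies in a cube of comparable side taken from one of
  \<open>2\<^sup>n\<close> shifted dyadic grids, whose root cubes have side \<open>6 l\<close> and contain \<open>Q\<close>
  (\<open>cube_in_shifted_dyadic\<close>). So the mean of \<open>F\<close> over \<open>R\<close> is at most the mean over the root, which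
  is at most \<open>M f y\<close>, plus \<open>\<eta>\<close>, plus a multiple of \<open>B\<close>, plus the excess at \<open>x\<close> of the dyadic maximal
  function of \<open>h\<close> over the mean of \<open>h\<close> on the root.

  It remains to bound the integral of this excess by a multiple of \<open>B\<close> times the volume of the root
  (\<open>integral_dmax_le\<close>). This takes the place of the John-Nirenberg inequality. It is a stopping time
  argument, made entirely finite by considering only \<open>k\<close> dyadic generations and inducting on \<open>k\<close>: where
  the dyadic maximal function exceeds the root mean by more than \<open>2 B\<close>, the point lies in a maximal
  stopping cube, the stopping cubes fill at most half of the root, and inside each of them the
  induction hypothesis applies. No limit is taken in this induction; the bound is uniform
  in \<open>k\<close>, and monotone convergence lets \<open>k\<close> tend to infinity.
\<close>

section \<open>Averages and mean oscillations over cubes\<close>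

definition cube :: "real ^ 'n \<Rightarrow> real \<Rightarrow> (real ^ 'n) set" where
  "cube a l = cbox a (\<chi> i. a $ i + l)"

lemma cubes_iff: "Q \<in> cubes \<longleftrightarrow> (\<exists>a l. 0 < l \<and> Q = cube a l)"
  by (auto simp: cubes_def cube_def)

lemma cube_in_cubes: "0 < l \<Longrightarrow> cube a l \<in> cubes"
  using cubes_iff by blast

lemma mem_cube: "x \<in> cube a l \<longleftrightarrow> (\<forall>i. a $ i \<le> x $ i \<and> x $ i \<le> a $ i + l)"
  by (simp add: cube_def mem_box_cart)

lemma mem_cube_D: "x \<in> cube a l \<Longrightarrow> a $ i \<le> x $ i \<and> x $ i \<le> a $ i + l"
  by (simp add: mem_cube)

lemma cube_subset:
  assumes "\<And>i. b $ i \<le> a $ i \<and> a $ i + l \<le> b $ i + m"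
  shows "cube a l \<subseteq> cube b m"
proof
  fix x assume "x \<in> cube a l"
  then have "a $ i \<le> x $ i \<and> x $ i \<le> a $ i + l" for i by (simp add: mem_cube)
  with assms show "x \<in> cube b m" unfolding mem_cube by (meson order_trans)
qed

lemma measure_cube:
  fixes a :: "real ^ 'n"
  assumes "0 \<le> l"
  shows "measure lebesgue (cube a l) = l ^ CARD('n)"
proof -
  have "cbox a (\<chi> i. a $ i + l) \<noteq> {}"
    using assms by (auto simp: interval_ne_empty_cart)
  then have "measure lebesgue (cube a l) = (\<Prod>i\<in>UNIV. (\<chi> i. a $ i + l) $ i - a $ i)"
    unfolding cube_def by (simp add: content_cbox_cart)
  then show ?thesis by simp
qed

lemma measure_cube_pos: "0 < l \<Longrightarrow> 0 < measure lebesgue (cube a l)"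
  by (simp add: measure_cube)

lemma lmeasurable_cube [simp]: "cube a l \<in> lmeasurable"
  by (simp add: cube_def)

lemma cube_borel: "cube a l \<in> sets borel"
  by (simp add: cube_def)

lemma cube_sets [simp]: "cube a l \<in> sets lebesgue"
  by (simp add: cube_def)

lemma emeasure_cube:
  fixes a :: "real ^ 'n"
  assumes "0 \<le> l"
  shows "emeasure lebesgue (cube a l) = ennreal (l ^ CARD('n))"
  using assms by (simp add: emeasure_eq_measure2 measure_cube)

lemma L1_loc_cube: "f \<in> L1_loc \<Longrightarrow> set_integrable lebesgue (cube a l) f"
  by (simp add: L1_loc_def cube_def)

lemma lmeasurable_integrable_const:
  fixes c :: real
  assumes "A \<in> lmeasurable"
  shows "set_integrable lebesgue A (\<lambda>x. c)"
  using assms by (auto simp: fmeasurable_def set_integrable_def integrable_indicator_iff)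

lemma lmeasurable_integral_const:
  fixes c :: real
  assumes "A \<in> lmeasurable"
  shows "(LINT x:A|lebesgue. c) = c * measure lebesgue A"
  using assms by (simp add: set_lebesgue_integral_def fmeasurable_def)

lemma set_integrable_diff_const:
  fixes f :: "real ^ 'n \<Rightarrow> real"
  assumes "set_integrable lebesgue A f" "A \<in> lmeasurable"
  shows "set_integrable lebesgue A (\<lambda>x. f x - c)" "set_integrable lebesgue A (\<lambda>x. \<bar>f x - c\<bar>)"
proof -
  show *: "set_integrable lebesgue A (\<lambda>x. f x - c)"
    using assms by (intro set_integral_diff lmeasurable_integrable_const) auto
  show "set_integrable lebesgue A (\<lambda>x. \<bar>f x - c\<bar>)"
    using set_integrable_abs[OF *] .
qed

lemma avg_diff_const:
  fixes f :: "real ^ 'n \<Rightarrow> real"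
  assumes "set_integrable lebesgue A f" "A \<in> lmeasurable" "0 < measure lebesgue A"
  shows "avg f A - c = (LINT x:A|lebesgue. f x - c) / measure lebesgue A"
  using assms by (simp add: avg_def lmeasurable_integral_const lmeasurable_integrable_const set_integral_diff field_simps)

lemma set_integral_abs_le:
  fixes f :: "real ^ 'n \<Rightarrow> real"
  assumes "set_integrable lebesgue A f"
  shows "\<bar>LINT x:A|lebesgue. f x\<bar> \<le> (LINT x:A|lebesgue. \<bar>f x\<bar>)"
  using set_integral_norm_bound[OF assms] by simp

text \<open>Allowing the average over a subset of the domain of integration makes this serve both for nested
  cubes and, with equal sets, for a comparison with a constant.\<close>

lemma abs_avg_diff_le:
  fixes f :: "real ^ 'n \<Rightarrow> real"
  assumes f: "set_integrable lebesgue A f" and A: "A \<in> lmeasurable"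
    and Q: "Q \<subseteq> A" "Q \<in> sets lebesgue" "0 < measure lebesgue Q"
  shows "\<bar>avg f Q - c\<bar> \<le> (LINT x:A|lebesgue. \<bar>f x - c\<bar>) / measure lebesgue Q"
proof -
  have Q': "Q \<in> lmeasurable" using A Q by (metis fmeasurableI2)
  have fQ: "set_integrable lebesgue Q f" by (rule set_integrable_subset[OF f Q(2) Q(1)])
  have "\<bar>LINT x:Q|lebesgue. f x - c\<bar> \<le> (LINT x:Q|lebesgue. \<bar>f x - c\<bar>)"
    by (intro set_integral_abs_le set_integrable_diff_const fQ Q')
  also have "\<dots> \<le> (LINT x:A|lebesgue. \<bar>f x - c\<bar>)"
    using set_integrable_diff_const[OF f A, of c] set_integrable_diff_const[OF fQ Q', of c] Q
    unfolding set_lebesgue_integral_def set_integrable_def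
    by (intro integral_mono) (auto simp: indicator_def)
  finally show ?thesis
    using Q by (simp add: avg_diff_const[OF fQ Q' Q(3)] divide_right_mono)
qed

lemma avg_nonneg: "(\<And>x. 0 \<le> f x) \<Longrightarrow> 0 \<le> avg f A"
  by (simp add: avg_def set_lebesgue_integral_def)

lemma abs_avg_le:
  fixes f :: "real ^ 'n \<Rightarrow> real"
  assumes f: "set_integrable lebesgue A f" and A: "A \<in> lmeasurable" "0 < measure lebesgue A"
    and b: "\<And>x. x \<in> A \<Longrightarrow> \<bar>f x - c\<bar> \<le> b"
  shows "\<bar>avg f A - c\<bar> \<le> b"
proof -
  have "\<bar>avg f A - c\<bar> \<le> (LINT x:A|lebesgue. \<bar>f x - c\<bar>) / measure lebesgue A"
    by (rule abs_avg_diff_le[OF f A(1) subset_refl fmeasurableD[OF A(1)] A(2)])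
  also have "(LINT x:A|lebesgue. \<bar>f x - c\<bar>) \<le> (LINT x:A|lebesgue. b)"
    by (intro set_integral_mono lmeasurable_integrable_const set_integrable_diff_const f A) (use b in auto)
  finally show ?thesis using A by (simp add: lmeasurable_integral_const field_simps)
qed

text \<open>Up to the factor 2, the average may be replaced by any other constant: the average is itself
  within the mean deviation of that constant.\<close>

lemma mean_osc_le:
  fixes f :: "real ^ 'n \<Rightarrow> real"
  assumes f: "set_integrable lebesgue A f" and A: "A \<in> lmeasurable" "0 < measure lebesgue A"
  shows "mean_osc f A \<le> 2 * (LINT x:A|lebesgue. \<bar>f x - c\<bar>) / measure lebesgue A"
proof -
  let ?I = "LINT x:A|lebesgue. \<bar>f x - c\<bar>"
  note i = set_integrable_diff_const[OF f A(1)]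
  have c: "set_integrable lebesgue A (\<lambda>x. \<bar>avg f A - c\<bar>)" by (rule lmeasurable_integrable_const[OF A(1)])
  have "(LINT x:A|lebesgue. \<bar>f x - avg f A\<bar>) \<le> (LINT x:A|lebesgue. \<bar>f x - c\<bar> + \<bar>avg f A - c\<bar>)"
    by (intro set_integral_mono i set_integral_add c) auto
  also have "\<dots> = ?I + \<bar>avg f A - c\<bar> * measure lebesgue A"
    by (simp add: i c set_integral_add lmeasurable_integral_const[OF A(1)])
  also have "\<bar>avg f A - c\<bar> * measure lebesgue A \<le> ?I"
    using abs_avg_diff_le[OF f A(1) subset_refl _ A(2), of c] A by (simp add: fmeasurableD field_simps)
  finally show ?thesis using A by (simp add: mean_osc_def divide_right_mono)
qed

lemma mean_osc_nonneg: "0 \<le> mean_osc f A"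
  by (simp add: mean_osc_def set_lebesgue_integral_def)

lemma mean_osc_le_const:
  fixes f :: "real ^ 'n \<Rightarrow> real"
  assumes f: "set_integrable lebesgue A f" and A: "A \<in> lmeasurable" "0 < measure lebesgue A"
    and b: "\<And>x. x \<in> A \<Longrightarrow> \<bar>f x - c\<bar> \<le> b"
  shows "mean_osc f A \<le> 2 * b"
proof -
  have "(LINT x:A|lebesgue. \<bar>f x - c\<bar>) \<le> (LINT x:A|lebesgue. b)"
    by (intro set_integral_mono lmeasurable_integrable_const set_integrable_diff_const f A) (use b in auto)
  then have "2 * (LINT x:A|lebesgue. \<bar>f x - c\<bar>) / measure lebesgue A \<le> 2 * b"
    using A by (simp add: lmeasurable_integral_const field_simps)
  then show ?thesis using mean_osc_le[OF f A, of c] by linarith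
qed

lemma avg_diff:
  assumes "set_integrable lebesgue A f" "set_integrable lebesgue A g"
  shows "avg (\<lambda>x. f x - g x) A = avg f A - avg g A"
  using assms by (simp add: avg_def set_integral_diff diff_divide_distrib)

lemma mean_osc_diff_le:
  fixes f g :: "real ^ 'n \<Rightarrow> real"
  assumes f: "set_integrable lebesgue A f" and g: "set_integrable lebesgue A g"
    and A: "A \<in> lmeasurable"
  shows "mean_osc (\<lambda>x. f x - g x) A \<le> mean_osc f A + mean_osc g A"
proof -
  have fg: "set_integrable lebesgue A (\<lambda>x. f x - g x)" by (intro set_integral_diff f g)
  note i = set_integrable_diff_const[OF f A] set_integrable_diff_const[OF g A]
    set_integrable_diff_const[OF fg A]
  have "(LINT x:A|lebesgue. \<bar>f x - g x - avg (\<lambda>x. f x - g x) A\<bar>)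
      \<le> (LINT x:A|lebesgue. \<bar>f x - avg f A\<bar> + \<bar>g x - avg g A\<bar>)"
    by (intro set_integral_mono i set_integral_add) (auto simp: avg_diff[OF f g])
  also have "\<dots> = (LINT x:A|lebesgue. \<bar>f x - avg f A\<bar>) + (LINT x:A|lebesgue. \<bar>g x - avg g A\<bar>)"
    by (intro set_integral_add i)
  finally show ?thesis
    unfolding mean_osc_def by (simp add: add_divide_distrib[symmetric] divide_right_mono)
qed

text \<open>The map \<open>t \<mapsto> \<bar>t\<bar>\<close> is a contraction, so \<open>\<bar>f\<bar>\<close> deviates from \<open>\<bar>avg f A\<bar>\<close> by no more than \<open>f\<close>
  does from \<open>avg f A\<close>.\<close>

lemma mean_osc_abs_le:
  fixes f :: "real ^ 'n \<Rightarrow> real"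
  assumes f: "set_integrable lebesgue A f" and A: "A \<in> lmeasurable" "0 < measure lebesgue A"
  shows "mean_osc (\<lambda>x. \<bar>f x\<bar>) A \<le> 2 * mean_osc f A"
proof -
  have "(LINT x:A|lebesgue. \<bar>\<bar>f x\<bar> - \<bar>avg f A\<bar>\<bar>) \<le> (LINT x:A|lebesgue. \<bar>f x - avg f A\<bar>)"
    by (intro set_integral_mono set_integrable_diff_const set_integrable_abs f A) auto
  then have "2 * (LINT x:A|lebesgue. \<bar>\<bar>f x\<bar> - \<bar>avg f A\<bar>\<bar>) / measure lebesgue A \<le> 2 * mean_osc f A"
    using A by (simp add: mean_osc_def field_simps)
  then show ?thesis
    using mean_osc_le[OF set_integrable_abs[OF f] A, of "\<bar>avg f A\<bar>"] by simp
qed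

lemma integral_abs_diff_avg:
  assumes "0 < measure lebesgue A"
  shows "(LINT x:A|lebesgue. \<bar>f x - avg f A\<bar>) = mean_osc f A * measure lebesgue A"
  using assms by (simp add: mean_osc_def)

text \<open>Passing from a cube to a cube inside it costs the ratio of the volumes times the oscillation on the larger one.\<close>

lemma avg_nested_cubes:
  fixes f :: "real ^ 'n \<Rightarrow> real"
  assumes f: "f \<in> L1_loc" and sub: "cube a l \<subseteq> cube b m" and l: "0 < l" and m: "0 < m" "m \<le> r * l"
    and B: "mean_osc f (cube b m) \<le> B"
  shows "\<bar>avg f (cube a l) - avg f (cube b m)\<bar> \<le> r ^ CARD('n) * B"
proof -
  have "\<bar>avg f (cube a l) - avg f (cube b m)\<bar>
     \<le> (LINT x:cube b m|lebesgue. \<bar>f x - avg f (cube b m)\<bar>) / measure lebesgue (cube a l)"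
    by (intro abs_avg_diff_le L1_loc_cube f sub) (use l in \<open>auto simp: measure_cube_pos\<close>)
  also have "\<dots> = (m / l) ^ CARD('n) * mean_osc f (cube b m)"
    using l m by (simp add: integral_abs_diff_avg measure_cube power_divide)
  also have "\<dots> \<le> r ^ CARD('n) * B"
    using l m B mean_osc_nonneg[of f "cube b m"]
    by (intro mult_mono power_mono zero_le_power) (auto simp: field_simps intro: order_trans[of 0 "m / l"])
  finally show ?thesis .
qed

lemma bmo_norm_le_iff:
  "0 \<le> B \<Longrightarrow> bmo_norm f \<le> ennreal B \<longleftrightarrow> (\<forall>a l. 0 < l \<longrightarrow> mean_osc f (cube a l) \<le> B)"
  unfolding bmo_norm_def SUP_le_iff by (metis cubes_iff ennreal_le_iff)

lemma BMO_bound: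
  assumes "f \<in> BMO"
  shows "\<exists>B>0. \<forall>a l. 0 < l \<longrightarrow> mean_osc f (cube a l) \<le> B"
proof -
  define B where "B = enn2real (bmo_norm f)"
  have "bmo_norm f \<le> ennreal B" "0 \<le> B" using assms by (auto simp: BMO_def B_def less_top)
  then have "mean_osc f (cube a l) \<le> B + 1" if "0 < l" for a l
    using that bmo_norm_le_iff[of B f] by (smt (verit, best))
  then show ?thesis using \<open>0 \<le> B\<close> by (intro exI[of _ "B + 1"]) auto
qed

lemma BMO_I:
  assumes "f \<in> L1_loc" "0 \<le> B" "\<And>a l. 0 < l \<Longrightarrow> mean_osc f (cube a l) \<le> B"
  shows "f \<in> BMO"
proof -
  have "bmo_norm f \<le> ennreal B" using assms bmo_norm_le_iff by blast
  then show ?thesis using assms by (simp add: BMO_def) (metis ennreal_less_top le_less_trans)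
qed

lemma L1_loc_diff: "f \<in> L1_loc \<Longrightarrow> g \<in> L1_loc \<Longrightarrow> (\<lambda>x. f x - g x) \<in> L1_loc"
  by (auto simp: L1_loc_def intro: set_integral_diff)

lemma L1_loc_abs: "f \<in> L1_loc \<Longrightarrow> (\<lambda>x. \<bar>f x\<bar>) \<in> L1_loc"
  by (auto simp: L1_loc_def intro: set_integrable_abs)

lemma L1_loc_continuous:
  fixes f :: "real ^ 'n \<Rightarrow> real"
  assumes "continuous_on UNIV f"
  shows "f \<in> L1_loc"
  unfolding L1_loc_def mem_Collect_eq
proof (intro allI impI)
  fix K :: "(real ^ 'n) set" assume K: "compact K"
  have i: "integrable lborel (\<lambda>x. indicator K x *\<^sub>R f x)"
    by (intro borel_integrable_compact K continuous_on_subset[OF assms]) auto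
  then show "set_integrable lebesgue K f"
    unfolding set_integrable_def by (subst integrable_completion) (auto dest: borel_measurable_integrable)
qed

section \<open>Bisection of cubes\<close>

text \<open>Half-open cubes split exactly into half-open cubes of half the side, so that a point
  determines the dyadic cube that contains it. They differ from closed cubes by null sets.\<close>

definition hcube :: "real ^ 'n \<Rightarrow> real \<Rightarrow> (real ^ 'n) set" where
  "hcube a l = {x. \<forall>i. a $ i \<le> x $ i \<and> x $ i < a $ i + l}"

lemma hcube_subset_cube: "hcube a l \<subseteq> cube a l"
  by (auto simp: hcube_def mem_cube less_imp_le)

lemma hcube_eq: "hcube a l = cube a l - (\<Union>i. {x. x $ i = a $ i + l})"
  by (auto simp: hcube_def mem_cube less_le)

lemma hcube_borel: "hcube a l \<in> sets borel"
  unfolding hcube_eq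
  by (intro sets.Diff cube_borel sets.finite_UN) (auto intro!: borel_closed closed_Collect_eq continuous_intros)

lemma hcube_sets [simp]: "hcube a l \<in> sets lebesgue"
  by (rule sets_completionI_sets) (simp add: hcube_borel)

lemma AE_hcube_cube: "AE x in lebesgue. x \<in> hcube a l \<longleftrightarrow> x \<in> cube a l"
proof -
  have "negligible (\<Union>i. {x. x $ i = a $ i + l})"
    by (intro negligible_Union) (auto simp: cart_eq_inner_axis intro: negligible_hyperplane)
  then have "(\<Union>i. {x. x $ i = a $ i + l}) \<in> null_sets lebesgue"
    by (simp add: negligible_iff_null_sets)
  then show ?thesis
    by (rule AE_I') (auto simp: hcube_eq)
qed

lemma set_integrable_hcube: "f \<in> L1_loc \<Longrightarrow> set_integrable lebesgue (hcube a l) f"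
  by (rule set_integrable_subset[OF L1_loc_cube]) (auto intro: hcube_subset_cube[THEN subsetD])

lemma integral_hcube:
  fixes f :: "real ^ 'n \<Rightarrow> real"
  assumes "set_integrable lebesgue (cube a l) f"
  shows "(LINT x:hcube a l|lebesgue. f x) = (LINT x:cube a l|lebesgue. f x)"
proof (rule set_integral_cong_set)
  have "set_integrable lebesgue (hcube a l) f"
    by (rule set_integrable_subset[OF assms]) (auto intro: hcube_subset_cube[THEN subsetD])
  then show "set_borel_measurable lebesgue (hcube a l) f" "set_borel_measurable lebesgue (cube a l) f"
    using assms by (auto simp: set_integrable_def set_borel_measurable_def)
  show "AE x in lebesgue. x \<in> cube a l \<longleftrightarrow> x \<in> hcube a l" using AE_hcube_cube[of a l] by (simp add: eq_commute)
qed

lemma lmeasurable_hcube [simp]: "hcube a l \<in> lmeasurable"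
  by (meson fmeasurableI2 hcube_sets hcube_subset_cube lmeasurable_cube)

lemma measure_hcube:
  fixes a :: "real ^ 'n"
  assumes "0 \<le> l"
  shows "measure lebesgue (hcube a l) = l ^ CARD('n)"
  using integral_hcube[OF lmeasurable_integrable_const[OF lmeasurable_cube], of a l 1] assms
  by (simp add: lmeasurable_integral_const measure_cube)

lemma integral_hcube_eq_avg:
  fixes f :: "real ^ 'n \<Rightarrow> real"
  assumes "f \<in> L1_loc" "0 < l"
  shows "(LINT x:hcube a l|lebesgue. f x) = avg f (cube a l) * l ^ CARD('n)"
  using assms by (simp add: integral_hcube L1_loc_cube avg_def measure_cube)

text \<open>The corners of the \<open>2\<^sup>n\<close> halves of a cube are indexed by the set \<open>T\<close> of the coordinates in which
  the upper half is taken; \<open>upper a l x\<close> is the index of the half that contains \<open>x\<close>.\<close>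

definition child :: "real ^ 'n \<Rightarrow> real \<Rightarrow> 'n set \<Rightarrow> real ^ 'n" where
  "child a l T = (\<chi> i. a $ i + (if i \<in> T then l / 2 else 0))"

definition upper :: "real ^ 'n \<Rightarrow> real \<Rightarrow> real ^ 'n \<Rightarrow> 'n set" where
  "upper a l x = {i. a $ i + l / 2 \<le> x $ i}"

lemma mem_hcube_child: "x \<in> hcube (child a l T) (l / 2) \<longleftrightarrow> x \<in> hcube a l \<and> upper a l x = T"
proof (cases "0 < l")
  case True
  have "x \<in> hcube (child a l T) (l / 2) \<longleftrightarrow> (\<forall>i. (a $ i \<le> x $ i \<and> x $ i < a $ i + l) \<and> (a $ i + l / 2 \<le> x $ i \<longleftrightarrow> i \<in> T))"
    unfolding hcube_def child_def mem_Collect_eq vec_lambda_beta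
    by (intro iff_allI) (use True in \<open>auto split: if_splits\<close>)
  then show ?thesis by (auto simp: hcube_def upper_def)
next
  case False
  then have "hcube a l = {}" "hcube (child a l T) (l / 2) = {}"
    by (auto simp: hcube_def)
  then show ?thesis by simp
qed

lemma integral_bisect:
  fixes G :: "real ^ 'n \<Rightarrow> real"
  assumes "set_integrable lebesgue (hcube a l) G"
  shows "(LINT x:hcube a l|lebesgue. G x) = (\<Sum>T\<in>UNIV. LINT x:hcube (child a l T) (l / 2)|lebesgue. G x)"
proof -
  have eq: "hcube a l = (\<Union>T\<in>UNIV. hcube (child a l T) (l / 2))"
    by (auto simp: mem_hcube_child)
  show ?thesis
    by (subst eq, rule set_integral_finite_Union)
      (auto simp: disjoint_family_on_def mem_hcube_child intro!: set_integrable_subset[OF assms])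
qed

text \<open>A bound on the mean over cubes with side in one dyadic range propagates to all larger cubes by
  bisecting them until their side falls into that range.\<close>

lemma integral_le_on_all_cubes:
  fixes G :: "real ^ 'n \<Rightarrow> real"
  assumes G: "G \<in> L1_loc" and d: "0 < d"
    and small: "\<And>a l. d / 2 \<le> l \<Longrightarrow> l \<le> d \<Longrightarrow> (LINT x:cube a l|lebesgue. G x) \<le> C * l ^ CARD('n)"
    and l: "d / 2 \<le> l"
  shows "(LINT x:cube a l|lebesgue. G x) \<le> C * l ^ CARD('n)"
proof -
  have *: "d / 2 \<le> l \<Longrightarrow> l \<le> 2 ^ k * d \<Longrightarrow> (LINT x:cube a l|lebesgue. G x) \<le> C * l ^ CARD('n)" for k a l
  proof (induction k arbitrary: a l)
    case 0
    then show ?case using small by simp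
  next
    case (Suc k)
    show ?case
    proof (cases "l \<le> d")
      case False
      have "(LINT x:cube a l|lebesgue. G x) = (\<Sum>T\<in>UNIV. LINT x:cube (child a l T) (l / 2)|lebesgue. G x)"
        using integral_bisect[OF set_integrable_hcube[OF G], of a l] by (simp add: integral_hcube L1_loc_cube G)
      also have "\<dots> \<le> (\<Sum>T\<in>(UNIV :: 'n set set). C * (l / 2) ^ CARD('n))"
        by (intro sum_mono Suc.IH) (use False Suc.prems in auto)
      also have "\<dots> = C * l ^ CARD('n)"
        by (simp add: card_UNIV_set power_divide)
      finally show ?thesis .
    qed (use Suc.prems small in auto)
  qed
  obtain k :: nat where "l / d < 2 ^ k" using real_arch_pow[of 2 "l / d"] by auto
  then show ?thesis using *[OF l, of k] d by (simp add: field_simps)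
qed

section \<open>The dyadic maximal function with finitely many generations\<close>

text \<open>The largest average of \<open>f\<close> over the cubes containing \<open>x\<close> among those obtained from \<open>cube a l\<close> by
  at most \<open>k\<close> bisections. The recursion passes to the half containing \<open>x\<close>, so an induction on \<open>k\<close> can
  treat every half as a new root.\<close>

primrec dmax :: "(real ^ 'n \<Rightarrow> real) \<Rightarrow> nat \<Rightarrow> real ^ 'n \<Rightarrow> real \<Rightarrow> real ^ 'n \<Rightarrow> real" where
  "dmax f 0 a l x = avg f (cube a l)"
| "dmax f (Suc k) a l x = max (avg f (cube a l)) (dmax f k (child a l (upper a l x)) (l / 2) x)"

lemma avg_le_dmax: "avg f (cube a l) \<le> dmax f k a l x"
  by (cases k) auto

lemma upper_measurable: "upper a l \<in> measurable borel (count_space UNIV)"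
proof -
  have "upper a l -` {T} \<in> sets borel" for T
  proof -
    let ?H = "\<lambda>i. {x. a $ i + l / 2 \<le> x $ i}"
    have "x \<in> upper a l -` {T} \<longleftrightarrow> (\<forall>i. a $ i + l / 2 \<le> x $ i \<longleftrightarrow> i \<in> T)" for x
      unfolding vimage_singleton_eq upper_def set_eq_iff mem_Collect_eq ..
    then have "upper a l -` {T} = (\<Inter>i. if i \<in> T then ?H i else - ?H i)"
      by (intro set_eqI) (simp only: INT_iff UNIV_I ball_UNIV if_bool_eq_conj, auto)
    moreover have "?H i \<in> sets borel" for i
      by (intro borel_closed closed_Collect_le continuous_intros)
    ultimately show ?thesis
      by (simp only:) (intro sets.finite_INT, auto intro: borel_comp)
  qed
  then show ?thesis
    by (subst measurable_count_space_eq2) (auto simp: finite_UNIV)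
qed

lemma borel_measurable_dmax: "dmax f k a l \<in> borel_measurable borel"
proof (induction k arbitrary: a l)
  case (Suc k)
  have "(\<lambda>x. dmax f k (child a l (upper a l x)) (l / 2) x) \<in> borel_measurable borel"
    by (rule measurable_compose_countable'[OF Suc.IH upper_measurable]) auto
  then show ?case by (simp cong: measurable_cong)
qed (simp cong: measurable_cong)

lemma finite_range_dmax: "finite (range (dmax f k a l))"
proof (induction k arbitrary: a l)
  case (Suc k)
  have "range (dmax f (Suc k) a l) \<subseteq> max (avg f (cube a l)) ` (\<Union>T\<in>UNIV. range (dmax f k (child a l T) (l / 2)))"
    by auto
  then show ?case by (rule finite_subset) (use Suc in auto)
qed simp

lemma set_integrable_dmax: "set_integrable lebesgue (hcube b m) (dmax f k a l)"
proof -
  obtain C where C: "\<And>x. \<bar>dmax f k a l x\<bar> \<le> C"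
    using finite_imp_bounded[OF finite_range_dmax, of f k a l] by (auto simp: bounded_iff)
  have "0 \<le> C" using C[of 0] by linarith
  with C have "AE x in lebesgue. x \<in> hcube b m \<longrightarrow> norm (dmax f k a l x) \<le> norm C"
    by (intro AE_I2) auto
  moreover have "set_borel_measurable lebesgue (hcube b m) (dmax f k a l)"
    unfolding set_borel_measurable_def
    by (intro measurable_completion borel_measurable_scaleR borel_measurable_indicator)
       (auto simp: borel_measurable_dmax hcube_borel)
  ultimately show ?thesis
    by (intro set_integrable_bound[OF lmeasurable_integrable_const[OF lmeasurable_hcube, of b m C]])
qed

text \<open>Here \<open>t\<close> is the stopping level. A quantity that vanishes where the maximal function does not
  exceed \<open>t\<close> does not notice the average over a root at which the process has not stopped, so on each
  half it may be computed from that half alone.\<close>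

lemma integral_bisect_unstopped:
  fixes f :: "real ^ 'n \<Rightarrow> real" and \<phi> :: "real \<Rightarrow> real ^ 'n \<Rightarrow> real"
  assumes int: "set_integrable lebesgue (hcube a l) (\<lambda>x. \<phi> (dmax f (Suc k) a l x) x)"
    and le: "avg f (cube a l) \<le> t" and \<phi>: "\<And>m x. m \<le> t \<Longrightarrow> \<phi> m x = 0"
  shows "(LINT x:hcube a l|lebesgue. \<phi> (dmax f (Suc k) a l x) x)
    = (\<Sum>T\<in>UNIV. LINT x:hcube (child a l T) (l / 2)|lebesgue. \<phi> (dmax f k (child a l T) (l / 2) x) x)"
proof -
  have "\<phi> (max (avg f (cube a l)) m) x = \<phi> m x" for m x
    using le \<phi> by (cases "m \<le> t") (auto simp: max_def)
  then show ?thesis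
    unfolding integral_bisect[OF int]
    by (intro sum.cong refl set_lebesgue_integral_cong) (auto simp: mem_hcube_child)
qed

lemma avg_child_le:
  fixes f :: "real ^ 'n \<Rightarrow> real"
  assumes f: "f \<in> L1_loc" and l: "0 < l" and B: "mean_osc f (cube a l) \<le> B"
  shows "avg f (cube (child a l T) (l / 2)) \<le> avg f (cube a l) + 2 ^ CARD('n) * B"
proof -
  have "cube (child a l T) (l / 2) \<subseteq> cube a l"
    using l by (intro cube_subset) (auto simp: child_def)
  then have "\<bar>avg f (cube (child a l T) (l / 2)) - avg f (cube a l)\<bar> \<le> 2 ^ CARD('n) * B"
    using l by (intro avg_nested_cubes f B) auto
  then show ?thesis by linarith
qed

text \<open>The stopping time argument. Let \<open>q\<close> be the average over the root, stop at the level
  \<open>t = q + 2 B\<close>, and let \<open>E\<close> be the union of the stopping cubes, which is the set where \<open>dmax\<close> exceeds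
  \<open>t\<close>. On a stopping cube \<open>R\<close> two things hold. First, the average of \<open>f\<close> exceeds \<open>t\<close>, so
  \<open>2 B \<bar>R\<bar> \<le> \<integral>\<^sub>R (f - q)\<close>; summing, \<open>E\<close> fills at most half of the root. Second, the average over
  \<open>R\<close> exceeds \<open>t\<close> by at most \<open>D = 2\<^sup>n B\<close>, since the parent of \<open>R\<close> was not stopped; with the induction
  hypothesis, \<open>\<integral>\<^sub>R (dmax - t) \<le> (D + A) \<bar>R\<bar>\<close>. Both are combined in the function \<open>\<phi>\<close>, supported on \<open>E\<close>:
  with \<open>c = (D + A) / (2 B)\<close> they say that the integral of \<open>c (f - q) - (dmax - t)\<close> over \<open>R\<close> is
  nonnegative, and nonnegativity is inherited by unions. The constant \<open>A = (4 + 2\<^sup>n) B\<close> solves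
  \<open>A = 2 B + (D + A) / 2\<close>, which is what closes the induction.\<close>

lemma integral_dmax_le:
  fixes f :: "real ^ 'n \<Rightarrow> real"
  assumes f: "f \<in> L1_loc" and B: "0 < B" "\<And>a l. 0 < l \<Longrightarrow> mean_osc f (cube a l) \<le> B" and l: "0 < l"
  shows "(LINT x:hcube a l|lebesgue. dmax f k a l x - avg f (cube a l)) \<le> (4 + 2 ^ CARD('n)) * B * l ^ CARD('n)"
  using l
proof (induction k arbitrary: a l rule: less_induct)
  case (less k a l)
  define D where "D = 2 ^ CARD('n) * B"
  define A where "A = (4 + 2 ^ CARD('n)) * B"
  define c where "c = (D + A) / (2 * B)"
  define q where "q = avg f (cube a l)"
  define t where "t = q + 2 * B"
  define \<phi> where "\<phi> = (\<lambda>m x. if t < m then c * (f x - q) - (m - t) else 0)"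
  have D: "0 < D" and A: "0 < A" and c: "0 < c" using B by (auto simp: D_def A_def c_def add_pos_pos)
  have cB: "c * (2 * B) = D + A" using B by (simp add: c_def)
  have AD: "A = 4 * B + D" by (simp add: A_def D_def algebra_simps)
  have fi: "set_integrable lebesgue (hcube b m) f" for b m by (rule set_integrable_hcube[OF f])
  have \<phi>i: "set_integrable lebesgue (hcube b m) (\<lambda>x. \<phi> (dmax f j b m x) x)" for j b m
  proof -
    have S: "{x. t < dmax f j b m x} \<in> sets borel"
      using borel_measurable_dmax[of f j b m] by measurable
    have "set_integrable lebesgue (hcube b m) (\<lambda>x. c * (f x - q) - (dmax f j b m x - t))"
      by (intro set_integral_diff set_integrable_mult_right fi set_integrable_dmax
          set_integrable_diff_const lmeasurable_hcube)
    then have "set_integrable lebesgue (hcube b m \<inter> {x. t < dmax f j b m x}) (\<lambda>x. c * (f x - q) - (dmax f j b m x - t))"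
      by (rule set_integrable_subset) (use S in \<open>auto intro: sets.Int sets_completionI_sets\<close>)
    then show ?thesis
      unfolding set_integrable_def \<phi>_def
      by (rule back_subst[where P = "integrable lebesgue"]) (auto simp: indicator_def fun_eq_iff)
  qed
  \<comment> \<open>The property to be propagated through the generations is nonnegativity of the integral of \<open>\<phi>\<close>.\<close>
  have unstopped: "0 \<le> (LINT x:hcube b m|lebesgue. \<phi> (dmax f (Suc j) b m x) x)"
    if "avg f (cube b m) \<le> t" "\<And>T. 0 \<le> (LINT x:hcube (child b m T) (m / 2)|lebesgue. \<phi> (dmax f j (child b m T) (m / 2) x) x)" for j b m
  proof -
    have eq: "(LINT x:hcube b m|lebesgue. \<phi> (dmax f (Suc j) b m x) x)
        = (\<Sum>T\<in>UNIV. LINT x:hcube (child b m T) (m / 2)|lebesgue. \<phi> (dmax f j (child b m T) (m / 2) x) x)"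
      by (rule integral_bisect_unstopped[where \<phi> = \<phi> and t = t, OF \<phi>i that(1)]) (simp add: \<phi>_def)
    show ?thesis unfolding eq by (intro sum_nonneg that(2))
  qed
  have zero: "(LINT x:hcube b m|lebesgue. \<phi> (dmax f 0 b m x) x) = 0" if "avg f (cube b m) \<le> t" for b m
    using that by (simp add: \<phi>_def)
  \<comment> \<open>The induction hypothesis on \<open>k\<close> is used here, with the stopping cube as the new root.\<close>
  have stopped: "0 \<le> (LINT x:hcube b m|lebesgue. \<phi> (dmax f j b m x) x)"
    if "j < k" "0 < m" "avg f (cube b m) \<le> t + D" "t < avg f (cube b m)" for j b m
  proof -
    let ?p = "avg f (cube b m)" and ?m = "m ^ CARD('n)"
    have "(LINT x:hcube b m|lebesgue. \<phi> (dmax f j b m x) x)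
        = (LINT x:hcube b m|lebesgue. c * (f x - q) - (dmax f j b m x - ?p) - (?p - t))"
      by (intro set_lebesgue_integral_cong)
         (use that avg_le_dmax[of f b m j] in \<open>auto simp: \<phi>_def intro: less_le_trans\<close>)
    also have "\<dots> = c * ((?p - q) * ?m) - (LINT x:hcube b m|lebesgue. dmax f j b m x - ?p) - (?p - t) * ?m"
      using \<open>0 < m\<close>
      by (simp add: set_integral_diff fi set_integrable_dmax set_integrable_diff_const lmeasurable_integrable_const
          lmeasurable_integral_const measure_hcube integral_hcube_eq_avg[OF f] algebra_simps)
    also have "\<dots> \<ge> c * ((2 * B) * ?m) - A * ?m - D * ?m"
    proof -
      have "(LINT x:hcube b m|lebesgue. dmax f j b m x - ?p) \<le> A * ?m"
        unfolding A_def by (rule less.IH) (use that in auto)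
      moreover have "c * ((2 * B) * ?m) \<le> c * ((?p - q) * ?m)"
        using that c by (intro mult_left_mono mult_right_mono) (auto simp: t_def)
      moreover have "(?p - t) * ?m \<le> D * ?m" using that by (intro mult_right_mono) auto
      ultimately show ?thesis by linarith
    qed
    also have "c * ((2 * B) * ?m) - A * ?m - D * ?m = 0"
    proof -
      have "c * ((2 * B) * ?m) = (D + A) * ?m" unfolding cB[symmetric] by simp
      then show ?thesis by (simp add: distrib_right)
    qed
    finally show ?thesis .
  qed
  have *: "0 \<le> (LINT x:hcube b m|lebesgue. \<phi> (dmax f j b m x) x)"
    if "j < k" "0 < m" "avg f (cube b m) \<le> t + D" for j b m
    using that
  proof (induction j arbitrary: b m)
    case (0 b m)
    show ?case
    proof (cases "avg f (cube b m) \<le> t")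
      case True
      then show ?thesis using zero[of b m] by simp
    next
      case False
      with 0 show ?thesis by (intro stopped) auto
    qed
  next
    case (Suc j b m)
    show ?case
    proof (cases "avg f (cube b m) \<le> t")
      case True
      have "avg f (cube (child b m T) (m / 2)) \<le> t + D" for T
        using avg_child_le[OF f Suc.prems(2) B(2)[OF Suc.prems(2)], of b T] True by (simp add: D_def)
      with True Suc show ?thesis by (intro unstopped Suc.IH) auto
    next
      case False
      with Suc.prems show ?thesis by (intro stopped) auto
    qed
  qed
  have main: "0 \<le> (LINT x:hcube a l|lebesgue. \<phi> (dmax f k a l x) x)"
  proof (cases k)
    case 0
    then show ?thesis using zero[of a l] B by (simp add: t_def q_def)
  next
    case (Suc j)
    show ?thesis
      unfolding Suc
    proof (rule unstopped)
      show "avg f (cube a l) \<le> t" using B by (simp add: t_def q_def)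
      show "0 \<le> (LINT x:hcube (child a l T) (l / 2)|lebesgue. \<phi> (dmax f j (child a l T) (l / 2) x) x)" for T
        using avg_child_le[OF f less.prems B(2)[OF less.prems], of a T] less.prems B
        by (intro *) (auto simp: Suc t_def q_def D_def)
    qed
  qed
  let ?n = "l ^ CARD('n)"
  have "(LINT x:hcube a l|lebesgue. dmax f k a l x - q)
      \<le> (LINT x:hcube a l|lebesgue. 2 * B + c * \<bar>f x - q\<bar> - \<phi> (dmax f k a l x) x)"
  proof (intro set_integral_mono)
    fix x
    have "c * (f x - q) \<le> c * \<bar>f x - q\<bar>" using c by simp
    then show "dmax f k a l x - q \<le> 2 * B + c * \<bar>f x - q\<bar> - \<phi> (dmax f k a l x) x"
      using c by (auto simp: \<phi>_def t_def not_less intro: add_increasing2)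
  qed (intro set_integral_diff set_integral_add set_integrable_mult_right fi set_integrable_dmax \<phi>i
         set_integrable_diff_const lmeasurable_integrable_const lmeasurable_hcube)+
  also have "\<dots> = 2 * B * ?n + c * (LINT x:hcube a l|lebesgue. \<bar>f x - q\<bar>) - (LINT x:hcube a l|lebesgue. \<phi> (dmax f k a l x) x)"
    using less.prems
    by (simp add: set_integral_diff set_integral_add fi \<phi>i set_integrable_diff_const lmeasurable_integrable_const
      lmeasurable_integral_const measure_hcube)
  also have "\<dots> \<le> 2 * B * ?n + c * (B * ?n)"
  proof -
    have "(LINT x:hcube a l|lebesgue. \<bar>f x - q\<bar>) = mean_osc f (cube a l) * ?n"
      using less.prems
      by (simp add: integral_hcube set_integrable_diff_const L1_loc_cube f integral_abs_diff_avg measure_cube q_def)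
    also have "\<dots> \<le> B * ?n" using B(2)[OF less.prems] less.prems by (intro mult_right_mono) auto
    finally show ?thesis using main c by (smt (verit) mult_left_mono)
  qed
  also have "\<dots> = A * ?n"
  proof -
    have "2 * B + c * B = A" using cB AD by linarith
    then show ?thesis by (metis mult.assoc distrib_right)
  qed
  finally show ?case by (simp add: q_def A_def)
qed

section \<open>Mollification, and Sarason's criterion for VMO\<close>

lemma infnorm_le_iff: "infnorm (x :: real ^ 'n) \<le> r \<longleftrightarrow> (\<forall>i. \<bar>x $ i\<bar> \<le> r)"
proof
  assume "\<forall>i. \<bar>x $ i\<bar> \<le> r"
  then show "infnorm x \<le> r"
    unfolding infnorm_cart by (intro cSup_least) auto
qed (meson component_le_infnorm_cart order_trans)

lemma lebesgue_integral_translate: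
  fixes h :: "real ^ 'n \<Rightarrow> real"
  assumes h: "h \<in> borel_measurable borel"
  shows "(LINT z|lebesgue. h (v + z)) = (LINT z|lebesgue. h z)"
proof -
  have "(LINT z|lebesgue. h z) = (LINT z|lborel. h z)"
    using h by (intro integral_completion) auto
  also have "\<dots> = (LINT z|distr lborel borel ((+) v). h z)"
    by (simp add: lborel_distr_plus)
  also have "\<dots> = (LINT z|lborel. h (v + z))"
    using h by (subst integral_distr) auto
  also have "\<dots> = (LINT z|lebesgue. h (v + z))"
    using h by (intro integral_completion[symmetric]) auto
  finally show ?thesis by simp
qed

definition ccube :: "real ^ 'n \<Rightarrow> real \<Rightarrow> (real ^ 'n) set" where
  "ccube x r = cube (\<chi> i. x $ i - r) (2 * r)"

lemma mem_ccube: "z \<in> ccube x r \<longleftrightarrow> infnorm (z - x) \<le> r"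
  by (auto simp: ccube_def mem_cube infnorm_le_iff abs_le_iff algebra_simps)

text \<open>A Lipschitz kernel is needed: averages over cubes would require a bound for the integral over thin
  shells to be uniformly continuous. Taking the sup norm makes the support a cube.\<close>

definition kern :: "real \<Rightarrow> real ^ 'n \<Rightarrow> real" where
  "kern d w = max 0 (d - infnorm w)"

text \<open>Only the dimension enters, through the type argument.\<close>

definition kern_mass :: "real \<Rightarrow> 'n::finite itself \<Rightarrow> real" where
  "kern_mass d _ = (LINT w|lebesgue. kern d (w :: real ^ 'n))"

definition smooth :: "real \<Rightarrow> (real ^ 'n \<Rightarrow> real) \<Rightarrow> real ^ 'n \<Rightarrow> real" where
  "smooth d f x = (LINT z|lebesgue. kern d (z - x) * f z) / kern_mass d TYPE('n)"

lemma kern_nonneg: "0 \<le> kern d w"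
  by (simp add: kern_def)

lemma kern_le: "0 \<le> d \<Longrightarrow> kern d w \<le> d"
  by (simp add: kern_def infnorm_pos_le)

lemma kern_outside: "z \<notin> ccube x d \<Longrightarrow> kern d (z - x) = 0"
  by (simp add: kern_def mem_ccube)

lemma kern_lipschitz: "\<bar>kern d (z - x) - kern d (z - y)\<bar> \<le> infnorm (x - y)"
proof -
  have "\<bar>infnorm (z - x) - infnorm (z - y)\<bar> \<le> infnorm (x - y)"
    using absdiff_infnorm[of "z - x" "z - y"] infnorm_sub[of y x] by simp
  then show ?thesis by (simp add: kern_def max_def abs_if split: if_splits)
qed

lemma kern_borel: "(\<lambda>z. kern d (z - x)) \<in> borel_measurable borel"
  unfolding kern_def by (intro borel_measurable_continuous_onI continuous_intros)

lemma set_integrable_kern: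
  fixes f :: "real ^ 'n \<Rightarrow> real"
  assumes f: "set_integrable lebesgue A f" and d: "0 \<le> d"
  shows "set_integrable lebesgue A (\<lambda>z. kern d (z - x) * f z)"
proof (rule set_integrable_bound)
  show "set_integrable lebesgue A (\<lambda>z. d * f z)" using f by simp
  have "(\<lambda>z. kern d (z - x) * (indicator A z *\<^sub>R f z)) \<in> borel_measurable lebesgue"
    using f kern_borel[of d x]
    by (intro borel_measurable_times) (auto simp: set_integrable_def dest: borel_measurable_integrable intro!: measurable_completion[of _ lborel])
  then show "set_borel_measurable lebesgue A (\<lambda>z. kern d (z - x) * f z)"
    by (simp add: set_borel_measurable_def mult_ac)
  show "AE z in lebesgue. z \<in> A \<longrightarrow> norm (kern d (z - x) * f z) \<le> norm (d * f z)"
    using d by (auto simp: abs_mult kern_le kern_nonneg intro!: mult_right_mono)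
qed

lemma integral_kern_supported:
  fixes f :: "real ^ 'n \<Rightarrow> real"
  assumes "ccube x d \<subseteq> A"
  shows "(LINT z|lebesgue. kern d (z - x) * f z) = (LINT z:A|lebesgue. kern d (z - x) * f z)"
  unfolding set_lebesgue_integral_def
  by (intro Bochner_Integration.integral_cong refl) (use assms kern_outside in \<open>auto simp: indicator_def\<close>)

lemma kern_mass_shift: "(LINT z|lebesgue. kern d (z - x)) = kern_mass d TYPE('n)" for x :: "real ^ 'n"
  using lebesgue_integral_translate[of "\<lambda>z. kern d (z - 0)" "- x"]
  by (simp add: kern_mass_def kern_borel kern_borel[of d 0, simplified])

text \<open>The kernel is at least \<open>d / 2\<close> on a cube of side \<open>d\<close>.\<close>

lemma kern_mass_ge:
  assumes d: "0 < d"
  shows "d / 2 * d ^ CARD('n) \<le> kern_mass d TYPE('n::finite)"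
proof -
  let ?A = "ccube (0 :: real ^ 'n) d" and ?B = "ccube (0 :: real ^ 'n) (d / 2)"
  have k: "set_integrable lebesgue A (\<lambda>z. kern d (z - 0) * 1)" if "A \<in> lmeasurable" for A :: "(real ^ 'n) set"
    using that d by (intro set_integrable_kern lmeasurable_integrable_const) auto
  have l: "?A \<in> lmeasurable" "?B \<in> lmeasurable" by (auto simp: ccube_def)
  have "d / 2 * d ^ CARD('n) = (LINT z:?B|lebesgue. d / 2)"
    using d by (simp add: lmeasurable_integral_const l) (simp add: ccube_def measure_cube)
  also have "\<dots> \<le> (LINT z:?B|lebesgue. kern d (z - 0) * 1)"
    using d by (intro set_integral_mono k l lmeasurable_integrable_const) (auto simp: mem_ccube kern_def)
  also have "\<dots> \<le> (LINT z:?A|lebesgue. kern d (z - 0) * 1)"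
    using k[OF l(1)] k[OF l(2)] d unfolding set_lebesgue_integral_def set_integrable_def
    by (intro integral_mono) (auto simp: indicator_def kern_nonneg mem_ccube)
  also have "\<dots> = (LINT z|lebesgue. kern d (z - (0 :: real ^ 'n)) * 1)"
    by (rule integral_kern_supported[of 0 d ?A "\<lambda>_. 1", symmetric]) simp
  also have "\<dots> = kern_mass d TYPE('n)"
    by (simp add: kern_mass_def)
  finally show ?thesis .
qed

lemma kern_mass_pos: "0 < d \<Longrightarrow> 0 < kern_mass d TYPE('n::finite)"
  using kern_mass_ge[of d, where 'n = 'n] by (smt (verit) mult_pos_pos half_gt_zero zero_less_power)

lemma smooth_diff_const:
  fixes f :: "real ^ 'n \<Rightarrow> real"
  assumes f: "set_integrable lebesgue A f" and A: "A \<in> lmeasurable" "ccube x d \<subseteq> A" and d: "0 < d"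
  shows "smooth d f x - c = (LINT z:A|lebesgue. kern d (z - x) * (f z - c)) / kern_mass d TYPE('n)"
proof -
  have "(LINT z:A|lebesgue. kern d (z - x) * (f z - c))
    = (LINT z:A|lebesgue. kern d (z - x) * f z) - (LINT z:A|lebesgue. kern d (z - x) * c)"
    using d unfolding right_diff_distrib
    by (intro set_integral_diff set_integrable_kern f lmeasurable_integrable_const A) auto
  also have "(LINT z:A|lebesgue. kern d (z - x) * c) = c * kern_mass d TYPE('n)"
    unfolding integral_kern_supported[OF A(2), of "\<lambda>_. c", symmetric] by (simp add: kern_mass_shift)
  also have "(LINT z:A|lebesgue. kern d (z - x) * f z) = smooth d f x * kern_mass d TYPE('n)"
    using kern_mass_pos[OF d, where 'n = 'n]
    by (simp add: smooth_def integral_kern_supported[OF A(2), of f, symmetric])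
  finally show ?thesis
    using kern_mass_pos[OF d, where 'n = 'n] by (simp add: left_diff_distrib[symmetric])
qed

text \<open>The kernel is bounded by \<open>d\<close> and has mass at least \<open>d\<^sup>n\<^sup>+\<^sup>1 / 2\<close>.\<close>

lemma smooth_near_const:
  fixes f :: "real ^ 'n \<Rightarrow> real"
  assumes f: "set_integrable lebesgue A f" and A: "A \<in> lmeasurable" "ccube x d \<subseteq> A" and d: "0 < d"
  shows "\<bar>smooth d f x - c\<bar> \<le> 2 * (LINT z:A|lebesgue. \<bar>f z - c\<bar>) / d ^ CARD('n)"
proof -
  note i = set_integrable_diff_const[OF f A(1), of c]
  let ?I = "LINT z:A|lebesgue. \<bar>f z - c\<bar>"
  have I: "0 \<le> ?I" by (simp add: set_lebesgue_integral_def)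
  have "\<bar>LINT z:A|lebesgue. kern d (z - x) * (f z - c)\<bar> \<le> (LINT z:A|lebesgue. \<bar>kern d (z - x) * (f z - c)\<bar>)"
    using d by (intro set_integral_abs_le set_integrable_kern i) auto
  also have "\<dots> \<le> (LINT z:A|lebesgue. d * \<bar>f z - c\<bar>)"
    using d by (intro set_integral_mono set_integrable_abs set_integrable_kern i set_integrable_mult_right)
      (auto simp: abs_mult kern_le kern_nonneg intro!: mult_right_mono)
  finally have "\<bar>smooth d f x - c\<bar> \<le> d * ?I / kern_mass d TYPE('n)"
    using kern_mass_pos[OF d, where 'n = 'n]
    by (simp add: smooth_diff_const[OF f A d] divide_right_mono)
  also have "\<dots> \<le> d * ?I / (d / 2 * d ^ CARD('n))"
    using kern_mass_ge[OF d, where 'n = 'n] kern_mass_pos[OF d, where 'n = 'n] d I by (intro divide_left_mono) auto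
  finally show ?thesis using d by (simp add: mult.commute)
qed

lemma smooth_lipschitz:
  fixes f :: "real ^ 'n \<Rightarrow> real"
  assumes f: "set_integrable lebesgue A f" and A: "A \<in> lmeasurable" "ccube x d \<subseteq> A" "ccube y d \<subseteq> A" and d: "0 < d"
  shows "\<bar>smooth d f x - smooth d f y\<bar>
     \<le> infnorm (x - y) * (LINT z:A|lebesgue. \<bar>f z - c\<bar>) / kern_mass d TYPE('n)"
proof -
  note i = set_integrable_diff_const[OF f A(1), of c]
  have k: "set_integrable lebesgue A (\<lambda>z. kern d (z - w) * (f z - c))" for w
    using d by (intro set_integrable_kern i) auto
  have "smooth d f x - smooth d f y = (smooth d f x - c) - (smooth d f y - c)" by simp
  also have "\<dots> = (LINT z:A|lebesgue. kern d (z - x) * (f z - c) - kern d (z - y) * (f z - c)) / kern_mass d TYPE('n)"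
    unfolding smooth_diff_const[OF f A(1) A(2) d] smooth_diff_const[OF f A(1) A(3) d]
    by (simp add: set_integral_diff k diff_divide_distrib)
  finally have eq: "smooth d f x - smooth d f y = \<dots>" .
  have "\<bar>LINT z:A|lebesgue. kern d (z - x) * (f z - c) - kern d (z - y) * (f z - c)\<bar>
      \<le> (LINT z:A|lebesgue. \<bar>kern d (z - x) * (f z - c) - kern d (z - y) * (f z - c)\<bar>)"
    by (intro set_integral_abs_le set_integral_diff k)
  also have "\<dots> \<le> (LINT z:A|lebesgue. infnorm (x - y) * \<bar>f z - c\<bar>)"
    by (intro set_integral_mono set_integrable_abs set_integral_diff k i set_integrable_mult_right)
       (auto simp: left_diff_distrib[symmetric] abs_mult intro!: mult_right_mono kern_lipschitz)
  finally show ?thesis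
    using kern_mass_pos[OF d, where 'n = 'n] by (simp add: eq divide_right_mono)
qed

text \<open>At distances at most \<open>d\<close> the two kernels have supports in one cube of side \<open>4 d\<close>. Subtracting
  the average over that cube, which the mollification reproduces, leaves the mean oscillation, and that
  is bounded independently of the position.\<close>

lemma uniformly_continuous_smooth:
  fixes f :: "real ^ 'n \<Rightarrow> real"
  assumes f: "f \<in> BMO" and d: "0 < d"
  shows "uniformly_continuous_on UNIV (smooth d f)"
proof -
  obtain B where B: "0 < B" "\<And>a l. 0 < l \<Longrightarrow> mean_osc f (cube a l) \<le> B" using BMO_bound[OF f] by auto
  have f1: "f \<in> L1_loc" using f by (simp add: BMO_def)
  define C where "C = B * (4 * d) ^ CARD('n) / kern_mass d TYPE('n)"
  have C: "0 < C" using B d kern_mass_pos[OF d, where 'n = 'n] by (simp add: C_def)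
  have lip: "\<bar>smooth d f x - smooth d f y\<bar> \<le> C * dist x y" if "dist x y \<le> d" for x y
  proof -
    let ?A = "ccube x (2 * d)"
    have le: "infnorm (x - y) \<le> dist x y" by (simp add: dist_norm infnorm_le_norm)
    have "z \<in> ?A" if "z \<in> ccube y d" for z
      using that infnorm_triangle[of "z - y" "y - x"] le \<open>dist x y \<le> d\<close> infnorm_sub[of y x]
      by (simp add: mem_ccube)
    then have sub: "ccube x d \<subseteq> ?A" "ccube y d \<subseteq> ?A" using d by (auto simp: mem_ccube)
    have "set_integrable lebesgue ?A f" "?A \<in> lmeasurable" by (simp_all add: ccube_def L1_loc_cube f1)
    with sub have "\<bar>smooth d f x - smooth d f y\<bar>
        \<le> infnorm (x - y) * (LINT z:?A|lebesgue. \<bar>f z - avg f ?A\<bar>) / kern_mass d TYPE('n)"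
      using d by (intro smooth_lipschitz)
    also have "(LINT z:?A|lebesgue. \<bar>f z - avg f ?A\<bar>) \<le> B * (4 * d) ^ CARD('n)"
      using d B by (simp add: ccube_def integral_abs_diff_avg measure_cube mult_right_mono)
    then have "infnorm (x - y) * (LINT z:?A|lebesgue. \<bar>f z - avg f ?A\<bar>) / kern_mass d TYPE('n) \<le> dist x y * (B * (4 * d) ^ CARD('n)) / kern_mass d TYPE('n)"
      using le B d kern_mass_pos[OF d, where 'n = 'n] 
      by (intro divide_right_mono mult_mono) (auto simp: set_lebesgue_integral_def)
    finally show ?thesis by (simp add: C_def mult_ac)
  qed
  show ?thesis
    unfolding uniformly_continuous_on_def
  proof (intro allI impI)
    fix e :: real assume e: "0 < e"
    show "\<exists>r>0. \<forall>x\<in>UNIV. \<forall>x'\<in>UNIV. dist x' x < r \<longrightarrow> dist (smooth d f x') (smooth d f x) < e"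
    proof (intro exI[of _ "min d (e / C)"] conjI ballI impI)
      fix x x' :: "real ^ 'n" assume "dist x' x < min d (e / C)"
      then have "\<bar>smooth d f x' - smooth d f x\<bar> \<le> C * dist x' x" "C * dist x' x < e"
        using lip[of x' x] C by (auto simp: field_simps)
      then show "dist (smooth d f x') (smooth d f x) < e" by (simp add: dist_real_def)
    qed (use d e C in auto)
  qed
qed

text \<open>On a cube of side at most \<open>d\<close>, the mollification is nearly equal to the average of \<open>f\<close> over a
  cube of side at most \<open>3 d\<close>, so both \<open>f\<close> and its mollification oscillate little. When the side is also
  at least \<open>d / 2\<close>, this shows that even the mean of \<open>\<bar>f - smooth d f\<bar>\<close> is small, and that property,
  unlike the oscillation, passes to larger cubes by bisection.\<close>

lemma mean_osc_diff_smooth: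
  fixes f :: "real ^ 'n \<Rightarrow> real"
  assumes f: "f \<in> BMO" and d: "0 < d" and l: "0 < l"
    and w: "\<And>a l. 0 < l \<Longrightarrow> l \<le> 3 * d \<Longrightarrow> mean_osc f (cube a l) \<le> w"
  shows "mean_osc (\<lambda>x. f x - smooth d f x) (cube a l) \<le> 8 * 6 ^ CARD('n) * w"
proof -
  let ?n = "CARD('n)"
  have f1: "f \<in> L1_loc" using f by (simp add: BMO_def)
  have s1: "smooth d f \<in> L1_loc"
    by (intro L1_loc_continuous uniformly_continuous_imp_continuous uniformly_continuous_smooth f d)
  have fs: "(\<lambda>x. f x - smooth d f x) \<in> L1_loc" by (intro L1_loc_diff f1 s1)
  have w0: "0 \<le> w" using w[of d 0] mean_osc_nonneg[of f "cube 0 d"] d by linarith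
  have p: "(3 :: real) ^ ?n \<le> 6 ^ ?n" "(1 :: real) \<le> 6 ^ ?n" by (auto intro: power_mono)
  have near: "\<exists>c. (\<forall>x\<in>cube b m. \<bar>smooth d f x - c\<bar> \<le> 2 * 3 ^ ?n * w)
      \<and> (LINT x:cube b m|lebesgue. \<bar>f x - c\<bar>) \<le> (3 * d) ^ ?n * w" if m: "0 < m" "m \<le> d" for b m
  proof (intro exI conjI ballI)
    let ?P = "cube (\<chi> i. b $ i - d) (m + 2 * d)"
    let ?c = "avg f ?P"
    have "(LINT x:?P|lebesgue. \<bar>f x - ?c\<bar>) = (m + 2 * d) ^ ?n * mean_osc f ?P"
      using m d by (simp add: integral_abs_diff_avg measure_cube)
    also have "\<dots> \<le> (3 * d) ^ ?n * w"
      using m d w by (intro mult_mono power_mono) (auto simp: mean_osc_nonneg)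
    finally have P: "(LINT x:?P|lebesgue. \<bar>f x - ?c\<bar>) \<le> (3 * d) ^ ?n * w" .
    have bP: "cube b m \<subseteq> ?P"
      using d by (intro cube_subset) auto
    have "(LINT x:cube b m|lebesgue. \<bar>f x - ?c\<bar>) \<le> (LINT x:?P|lebesgue. \<bar>f x - ?c\<bar>)"
      using set_integrable_diff_const(2)[OF L1_loc_cube[OF f1], of "\<chi> i. b $ i - d" "m + 2 * d" ?c]
        set_integrable_diff_const(2)[OF L1_loc_cube[OF f1], of b m ?c] d
      unfolding set_lebesgue_integral_def set_integrable_def
      by (intro integral_mono) (use bP in \<open>auto simp: indicator_def\<close>)
    with P show "(LINT x:cube b m|lebesgue. \<bar>f x - ?c\<bar>) \<le> (3 * d) ^ ?n * w" by linarith
    fix x assume x: "x \<in> cube b m"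
    have "\<bar>smooth d f x - ?c\<bar> \<le> 2 * (LINT z:?P|lebesgue. \<bar>f z - ?c\<bar>) / d ^ ?n"
    proof (intro smooth_near_const L1_loc_cube f1 d lmeasurable_cube)
      show "ccube x d \<subseteq> ?P"
        unfolding ccube_def
      proof (intro cube_subset)
        fix i
        have "b $ i \<le> x $ i \<and> x $ i \<le> b $ i + m" using x by (simp add: mem_cube)
        then show "(\<chi> i. b $ i - d) $ i \<le> (\<chi> i. x $ i - d) $ i
            \<and> (\<chi> i. x $ i - d) $ i + 2 * d \<le> (\<chi> i. b $ i - d) $ i + (m + 2 * d)" by simp
      qed
    qed
    also have "\<dots> \<le> 2 * ((3 * d) ^ ?n * w) / d ^ ?n"
      using d P by (intro divide_right_mono mult_left_mono) auto
    also have "\<dots> = 2 * 3 ^ ?n * w" using d by (simp add: power_mult_distrib)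
    finally show "\<bar>smooth d f x - ?c\<bar> \<le> 2 * 3 ^ ?n * w" .
  qed
  show ?thesis
  proof (cases "l \<le> d")
    case True
    obtain c where c: "\<And>x. x \<in> cube a l \<Longrightarrow> \<bar>smooth d f x - c\<bar> \<le> 2 * 3 ^ ?n * w"
      using near[OF l True] by blast
    have "mean_osc (smooth d f) (cube a l) \<le> 2 * (2 * 3 ^ ?n * w)"
      using c l by (intro mean_osc_le_const L1_loc_cube s1) (auto simp: measure_cube_pos)
    moreover have "mean_osc f (cube a l) \<le> w" using l True d by (intro w) auto
    moreover have "mean_osc (\<lambda>x. f x - smooth d f x) (cube a l) \<le> mean_osc f (cube a l) + mean_osc (smooth d f) (cube a l)"
      by (intro mean_osc_diff_le L1_loc_cube f1 s1) auto
    ultimately have "mean_osc (\<lambda>x. f x - smooth d f x) (cube a l) \<le> (1 + 4 * 3 ^ ?n) * w"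
      by (simp add: algebra_simps)
    also have "\<dots> \<le> 8 * 6 ^ ?n * w" using w0 p by (intro mult_right_mono) linarith+
    finally show ?thesis .
  next
    case False
    have "(LINT x:cube a l|lebesgue. \<bar>f x - smooth d f x\<bar>) \<le> 4 * 6 ^ ?n * w * l ^ ?n"
    proof (rule integral_le_on_all_cubes[OF L1_loc_abs[OF fs] d])
      fix b m assume m: "d / 2 \<le> m" "m \<le> d"
      then have m0: "0 < m" using d by linarith
      obtain c where c: "\<And>x. x \<in> cube b m \<Longrightarrow> \<bar>smooth d f x - c\<bar> \<le> 2 * 3 ^ ?n * w"
        "(LINT x:cube b m|lebesgue. \<bar>f x - c\<bar>) \<le> (3 * d) ^ ?n * w"
        using near[OF m0 m(2)] by blast
      note i = L1_loc_cube[OF fs] L1_loc_cube[OF f1]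
      have "(LINT x:cube b m|lebesgue. \<bar>f x - smooth d f x\<bar>) \<le> (LINT x:cube b m|lebesgue. \<bar>f x - c\<bar> + 2 * 3 ^ ?n * w)"
        by (intro set_integral_mono set_integrable_abs i set_integral_add set_integrable_diff_const
             lmeasurable_cube lmeasurable_integrable_const) (use c(1) in force)
      also have "\<dots> = (LINT x:cube b m|lebesgue. \<bar>f x - c\<bar>) + 2 * 3 ^ ?n * w * m ^ ?n"
        using m0 by (simp add: set_integral_add i set_integrable_diff_const lmeasurable_integrable_const
            lmeasurable_integral_const measure_cube)
      also have "\<dots> \<le> (6 * m) ^ ?n * w + 2 * 6 ^ ?n * w * m ^ ?n"
      proof (intro add_mono)
        have "(3 * d) ^ ?n * w \<le> (6 * m) ^ ?n * w" using m d w0 by (intro mult_right_mono power_mono) auto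
        with c(2) show "(LINT x:cube b m|lebesgue. \<bar>f x - c\<bar>) \<le> (6 * m) ^ ?n * w" by linarith
        show "2 * 3 ^ ?n * w * m ^ ?n \<le> 2 * 6 ^ ?n * w * m ^ ?n"
          using p w0 m0 by (intro mult_right_mono mult_left_mono) auto
      qed
      also have "\<dots> \<le> 4 * 6 ^ ?n * w * m ^ ?n"
        using w0 m0 by (simp add: power_mult_distrib)
      finally show "(LINT x:cube b m|lebesgue. \<bar>f x - smooth d f x\<bar>) \<le> 4 * 6 ^ ?n * w * m ^ ?n" .
    qed (use False d in auto)
    then have "2 * (LINT x:cube a l|lebesgue. \<bar>f x - smooth d f x - 0\<bar>) / measure lebesgue (cube a l) \<le> 8 * 6 ^ ?n * w"
      using l by (simp add: measure_cube field_simps)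
    then show ?thesis
      using mean_osc_le[OF L1_loc_cube[OF fs] lmeasurable_cube measure_cube_pos[OF l], of a 0] by simp
  qed
qed

text \<open>The direction of Sarason's theorem that is not immediate. Mollifying at one third of the scale
  below which \<open>f\<close> oscillates little gives the approximation.\<close>

lemma VMO_I:
  fixes f :: "real ^ 'n \<Rightarrow> real"
  assumes f: "f \<in> BMO"
    and osc: "\<And>e. 0 < e \<Longrightarrow> \<exists>d>0. \<forall>a l. 0 < l \<longrightarrow> l \<le> d \<longrightarrow> mean_osc f (cube a l) \<le> e"
  shows "f \<in> VMO"
  unfolding VMO_def mem_Collect_eq
proof (intro conjI f allI impI)
  fix e :: real assume e: "0 < e"
  let ?C = "8 * 6 ^ CARD('n) :: real"
  have f1: "f \<in> L1_loc" using f by (simp add: BMO_def)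
  obtain B where B: "0 < B" "\<And>a l. 0 < l \<Longrightarrow> mean_osc f (cube a l) \<le> B" using BMO_bound[OF f] by auto
  obtain d where d: "0 < d" "\<And>a l. 0 < l \<Longrightarrow> l \<le> d \<Longrightarrow> mean_osc f (cube a l) \<le> e / 2 / ?C"
    using osc[of "e / 2 / ?C"] e by auto
  define g where "g = smooth (d / 3) f"
  have uc: "uniformly_continuous_on UNIV g"
    unfolding g_def using d by (intro uniformly_continuous_smooth f) auto
  have g1: "g \<in> L1_loc" using uc by (intro L1_loc_continuous uniformly_continuous_imp_continuous)
  have fg: "mean_osc (\<lambda>x. f x - g x) (cube a l) \<le> e / 2" if "0 < l" for a l
    using mean_osc_diff_smooth[OF f, of "d / 3" l "e / 2 / ?C" a] d that by (simp add: g_def)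
  have "bmo_norm (\<lambda>x. f x - g x) \<le> ennreal (e / 2)"
    using fg e by (subst bmo_norm_le_iff) auto
  then have lt: "bmo_norm (\<lambda>x. f x - g x) < ennreal e"
    using e by (metis ennreal_lessI half_gt_zero field_sum_of_halves less_add_same_cancel1 le_less_trans)
  have "g \<in> BMO"
  proof (rule BMO_I[OF g1])
    show "0 \<le> B + e / 2" using B e by simp
    fix a :: "real ^ 'n" and l :: real assume l: "0 < l"
    have "mean_osc (\<lambda>x. f x - (f x - g x)) (cube a l) \<le> mean_osc f (cube a l) + mean_osc (\<lambda>x. f x - g x) (cube a l)"
      by (intro mean_osc_diff_le L1_loc_cube L1_loc_diff f1 g1) auto
    then show "mean_osc g (cube a l) \<le> B + e / 2"
      using B(2)[OF l, of a] fg[OF l, of a] by simp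
  qed
  with uc lt show "\<exists>g\<in>BMO. uniformly_continuous_on UNIV g \<and> bmo_norm (\<lambda>x. f x - g x) < ennreal e"
    by blast
qed

section \<open>The maximal function\<close>

lemma maximal_eq:
  fixes f :: "real ^ 'n \<Rightarrow> real"
  assumes f: "f \<in> L1_loc"
  shows "maximal f x = (SUP Q\<in>{Q \<in> cubes. x \<in> Q}. ennreal (avg (\<lambda>x. \<bar>f x\<bar>) Q))"
  unfolding maximal_def
proof (rule SUP_cong[OF refl])
  fix Q assume "Q \<in> {Q \<in> cubes. x \<in> Q}"
  then obtain a l where Q: "0 < l" "Q = cube a l" by (auto simp: cubes_iff)
  have i: "set_integrable lebesgue Q (\<lambda>y. \<bar>f y\<bar>)"
    unfolding Q by (intro L1_loc_cube L1_loc_abs f)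
  have "(\<integral>\<^sup>+y\<in>Q. ennreal \<bar>f y\<bar> \<partial>lebesgue) = (\<integral>\<^sup>+y. ennreal (indicator Q y *\<^sub>R \<bar>f y\<bar>) \<partial>lebesgue)"
    by (intro nn_integral_cong) (auto simp: indicator_def)
  also have "\<dots> = ennreal (LINT y:Q|lebesgue. \<bar>f y\<bar>)"
    unfolding set_lebesgue_integral_def
    by (rule nn_integral_eq_integral) (use i in \<open>auto simp: set_integrable_def\<close>)
  finally have "(\<integral>\<^sup>+y\<in>Q. ennreal \<bar>f y\<bar> \<partial>lebesgue) = ennreal (LINT y:Q|lebesgue. \<bar>f y\<bar>)" .
  moreover have "emeasure lebesgue Q = ennreal (measure lebesgue Q)" "0 < measure lebesgue Q"
    using Q measure_cube_pos[OF Q(1), of a] by (simp_all only: emeasure_cube measure_cube less_imp_le)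
  moreover have "0 \<le> (LINT y:Q|lebesgue. \<bar>f y\<bar>)" by (simp add: set_lebesgue_integral_def)
  ultimately show "(\<integral>\<^sup>+y\<in>Q. ennreal \<bar>f y\<bar> \<partial>lebesgue) / emeasure lebesgue Q = ennreal (avg (\<lambda>x. \<bar>f x\<bar>) Q)"
    unfolding avg_def by (simp only: divide_ennreal)
qed

lemma avg_le_maximal:
  fixes f :: "real ^ 'n \<Rightarrow> real"
  assumes "f \<in> L1_loc" "0 < l" "x \<in> cube a l"
  shows "ennreal (avg (\<lambda>x. \<bar>f x\<bar>) (cube a l)) \<le> maximal f x"
  unfolding maximal_eq[OF assms(1)] by (rule SUP_upper) (use assms cube_in_cubes in auto)

lemma maximal_leI:
  fixes f :: "real ^ 'n \<Rightarrow> real"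
  assumes "f \<in> L1_loc" "\<And>a l. 0 < l \<Longrightarrow> x \<in> cube a l \<Longrightarrow> ennreal (avg (\<lambda>x. \<bar>f x\<bar>) (cube a l)) \<le> c"
  shows "maximal f x \<le> c"
  unfolding maximal_eq[OF assms(1)] by (rule SUP_least) (use assms(2) in \<open>auto simp: cubes_iff\<close>)

text \<open>The maximal function is lower semicontinuous although the cubes are closed: enlarging slightly a
  cube on which the average exceeds \<open>t\<close> keeps the average above \<open>t\<close>, and the enlarged cube is a
  competitor for all points near \<open>x\<close>.\<close>

lemma open_maximal_gt:
  fixes f :: "real ^ 'n \<Rightarrow> real"
  assumes f: "f \<in> L1_loc"
  shows "open {x. t < maximal f x}"
proof (subst open_contains_ball, safe)
  fix x assume "t < maximal f x"
  then obtain a l where l: "0 < l" "x \<in> cube a l" and t: "t < ennreal (avg (\<lambda>x. \<bar>f x\<bar>) (cube a l))"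
    unfolding maximal_eq[OF f] less_SUP_iff by (auto simp: cubes_iff)
  let ?F = "\<lambda>x. \<bar>f x\<bar>"
  let ?v = "avg ?F (cube a l)" and ?I = "\<lambda>A. LINT y:A|lebesgue. ?F y"
  have "((\<lambda>s. (l / (l + 2 * s)) ^ CARD('n) * ?v) \<longlongrightarrow> (l / (l + 2 * 0)) ^ CARD('n) * ?v) (at_right 0)"
    using l by (intro tendsto_intros) auto
  then have "((\<lambda>s. ennreal ((l / (l + 2 * s)) ^ CARD('n) * ?v)) \<longlongrightarrow> ennreal ?v) (at_right 0)"
    using l by (intro tendsto_ennrealI) simp
  then have "eventually (\<lambda>s. t < ennreal ((l / (l + 2 * s)) ^ CARD('n) * ?v)) (at_right 0)"
    using t by (rule order_tendstoD)
  then have "eventually (\<lambda>s. t < ennreal ((l / (l + 2 * s)) ^ CARD('n) * ?v) \<and> 0 < s) (at_right 0)"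
    by (intro eventually_conj) (auto simp: eventually_at_right_less)
  then obtain s where s: "0 < s" "t < ennreal ((l / (l + 2 * s)) ^ CARD('n) * ?v)"
    using eventually_happens'[OF trivial_limit_at_right_real] by blast
  let ?R = "cube (\<chi> i. a $ i - s) (l + 2 * s)"
  have sub: "cube a l \<subseteq> ?R" using s by (intro cube_subset) auto
  have "?I (cube a l) \<le> ?I ?R"
    using L1_loc_cube[OF L1_loc_abs[OF f], of a l] L1_loc_cube[OF L1_loc_abs[OF f], of "\<chi> i. a $ i - s" "l + 2 * s"]
    unfolding set_lebesgue_integral_def set_integrable_def
    by (intro integral_mono) (use sub in \<open>auto simp: indicator_def\<close>)
  then have "(l / (l + 2 * s)) ^ CARD('n) * ?v \<le> avg ?F ?R"
    using l s by (simp add: avg_def measure_cube power_divide divide_right_mono)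
  then have t': "t < ennreal (avg ?F ?R)" using s(2) by (metis ennreal_leI less_le_trans)
  have "ball x s \<subseteq> {x. t < maximal f x}"
  proof
    fix y assume y: "y \<in> ball x s"
    have "y \<in> ?R" unfolding mem_cube
    proof
      fix i
      have "\<bar>(x - y) $ i\<bar> < s" using y component_le_norm_cart[of "x - y" i] by (simp add: dist_norm)
      moreover have "a $ i \<le> x $ i \<and> x $ i \<le> a $ i + l" using l by (simp add: mem_cube)
      ultimately show "(\<chi> i. a $ i - s) $ i \<le> y $ i \<and> y $ i \<le> (\<chi> i. a $ i - s) $ i + (l + 2 * s)"
        by auto
    qed
    then have "ennreal (avg ?F ?R) \<le> maximal f y" using l s by (intro avg_le_maximal f) auto
    with t' show "y \<in> {x. t < maximal f x}" by auto
  qed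
  then show "\<exists>e>0. ball x e \<subseteq> {x. t < maximal f x}" using s by blast
qed

lemma borel_measurable_maximal:
  assumes "f \<in> L1_loc"
  shows "maximal f \<in> borel_measurable borel"
  by (rule borel_measurableI_greater) (use open_maximal_gt[OF assms] in \<open>auto intro: borel_open\<close>)

section \<open>Translations and shifted dyadic grids\<close>

lemma avg_translate:
  fixes g :: "real ^ 'n \<Rightarrow> real"
  assumes g: "continuous_on UNIV g" and r: "0 < r"
  shows "avg g (cube (a + v) r) = avg (\<lambda>z. g (v + z)) (cube a r)"
proof -
  have eq: "indicator (cube (a + v) r) (v + z) = (indicator (cube a r) z :: real)" for z
    by (simp add: indicator_def mem_cube algebra_simps)
  have m: "(\<lambda>z. indicator (cube (a + v) r) z *\<^sub>R g z) \<in> borel_measurable borel"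
    by (intro borel_measurable_scaleR borel_measurable_indicator cube_borel borel_measurable_continuous_onI g)
  show ?thesis
    unfolding avg_def set_lebesgue_integral_def
    using r by (subst lebesgue_integral_translate[OF m, of v, symmetric]) (simp add: eq measure_cube)
qed

text \<open>Treats the competitors whose side is at least that of \<open>Q\<close>. A cube and its translate by at most
  its side lie in a common cube of twice the side, and \<open>h\<close> is compared through the average over the
  latter.\<close>

lemma avg_shift_le:
  fixes g h :: "real ^ 'n \<Rightarrow> real"
  assumes g: "continuous_on UNIV g" and h: "h \<in> L1_loc"
    and B: "\<And>a l. 0 < l \<Longrightarrow> mean_osc h (cube a l) \<le> B"
    and \<eta>: "\<And>z. \<bar>g (v + z) - g z\<bar> \<le> \<eta>"
    and r: "0 < r" and v: "\<And>i. \<bar>v $ i\<bar> \<le> r"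
  shows "avg (\<lambda>x. g x + h x) (cube a r) \<le> avg (\<lambda>x. g x + h x) (cube (a + v) r) + \<eta> + 2 * 2 ^ CARD('n) * B"
proof -
  have g1: "g \<in> L1_loc" by (rule L1_loc_continuous[OF g])
  have gv: "(\<lambda>z. g (v + z)) \<in> L1_loc"
    by (intro L1_loc_continuous continuous_on_compose2[OF g] continuous_intros) auto
  have add: "avg (\<lambda>x. g x + h x) (cube b r) = avg g (cube b r) + avg h (cube b r)" for b
    using L1_loc_cube[OF g1] L1_loc_cube[OF h] by (simp add: avg_def set_integral_add add_divide_distrib)
  have "\<bar>avg (\<lambda>z. g (v + z) - g z) (cube a r) - 0\<bar> \<le> \<eta>"
    using r \<eta> by (intro abs_avg_le L1_loc_cube L1_loc_diff gv g1) (auto simp: measure_cube_pos)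
  then have 1: "\<bar>avg g (cube (a + v) r) - avg g (cube a r)\<bar> \<le> \<eta>"
    by (simp add: avg_diff L1_loc_cube gv g1 avg_translate[OF g r])
  let ?P = "cube (\<chi> i. min (a $ i) (a $ i + v $ i)) (2 * r)"
  have "cube a r \<subseteq> ?P" "cube (a + v) r \<subseteq> ?P"
  proof -
    have v': "- r \<le> v $ i \<and> v $ i \<le> r" for i using v[of i] by (simp add: abs_le_iff)
    show "cube a r \<subseteq> ?P"
    proof (rule cube_subset)
      fix i show "(\<chi> i. min (a $ i) (a $ i + v $ i)) $ i \<le> a $ i \<and> a $ i + r \<le> (\<chi> i. min (a $ i) (a $ i + v $ i)) $ i + 2 * r"
        using v'[of i] r by (auto simp: min_def)
    qed
    show "cube (a + v) r \<subseteq> ?P"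
    proof (rule cube_subset)
      fix i show "(\<chi> i. min (a $ i) (a $ i + v $ i)) $ i \<le> (a + v) $ i \<and> (a + v) $ i + r \<le> (\<chi> i. min (a $ i) (a $ i + v $ i)) $ i + 2 * r"
        using v'[of i] r by (auto simp: min_def)
    qed
  qed
  then have "\<bar>avg h (cube a r) - avg h ?P\<bar> \<le> 2 ^ CARD('n) * B" "\<bar>avg h (cube (a + v) r) - avg h ?P\<bar> \<le> 2 ^ CARD('n) * B"
    using r by (auto intro!: avg_nested_cubes h B)
  with 1 show ?thesis unfolding add by linarith
qed

text \<open>The one third trick in one dimension, for the grids of mesh \<open>H = 6 l / 2\<^sup>k\<close> through \<open>b\<close> and through
  \<open>b + 2 l\<close>. Since \<open>2 l / H = 2\<^sup>k / 3\<close> is not an integer, it is at distance at least \<open>1 / 3\<close> from every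
  integer; so points of the two grids are at distance at least \<open>H / 3\<close>, and an interval shorter than
  that cannot meet both.\<close>

lemma floor_eq_in_shifted_grid:
  fixes u b r l H :: real
  assumes H: "H = 6 * l / 2 ^ k" and l: "0 < l" and r: "0 \<le> r" "3 * r < H"
  shows "\<exists>s\<in>{0, 2 * l}. \<lfloor>(u - (b + s)) / H\<rfloor> = \<lfloor>(u + r - (b + s)) / H\<rfloor>"
proof (rule ccontr)
  assume neg: "\<not> ?thesis"
  have H0: "0 < H" using H l by simp
  have lH: "2 * l / H = 2 ^ k / 3" using l by (simp add: H)
  define U where "U = (u - b) / H"
  define \<rho> where "\<rho> = r / H"
  have \<rho>: "0 \<le> \<rho>" "3 * \<rho> < 1" using r H0 by (auto simp: \<rho>_def field_simps)
  have e: "(u - (b + 0)) / H = U" "(u + r - (b + 0)) / H = U + \<rho>"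
     "(u - (b + 2 * l)) / H = U - 2 ^ k / 3" "(u + r - (b + 2 * l)) / H = U + \<rho> - 2 ^ k / 3"
    by (simp_all add: U_def \<rho>_def lH[symmetric] diff_divide_distrib add_divide_distrib)
  have cross: "\<exists>j :: int. V < j \<and> j \<le> V + \<rho>" if "\<lfloor>V\<rfloor> \<noteq> \<lfloor>V + \<rho>\<rfloor>" for V :: real
    using that \<rho> by (intro exI[of _ "\<lfloor>V + \<rho>\<rfloor>"]) (smt (verit) floor_less_iff floor_mono of_int_floor_le floor_le_iff)
  have "\<lfloor>U\<rfloor> \<noteq> \<lfloor>U + \<rho>\<rfloor>" "\<lfloor>U - 2 ^ k / 3\<rfloor> \<noteq> \<lfloor>U + \<rho> - 2 ^ k / 3\<rfloor>"
    using neg unfolding bex_simps(5) by (metis e insertCI)+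
  moreover have "U + \<rho> - 2 ^ k / 3 = U - 2 ^ k / 3 + \<rho>" by simp
  ultimately have "\<lfloor>U\<rfloor> \<noteq> \<lfloor>U + \<rho>\<rfloor>" "\<lfloor>U - 2 ^ k / 3\<rfloor> \<noteq> \<lfloor>U - 2 ^ k / 3 + \<rho>\<rfloor>"
    by simp_all
  then obtain i j :: int where ij: "U < i" "i \<le> U + \<rho>" "U - 2 ^ k / 3 < j" "j \<le> U - 2 ^ k / 3 + \<rho>"
    using cross by meson
  then have "\<bar>3 * (real_of_int i - real_of_int j) - 2 ^ k\<bar> < 1" using \<rho> by (simp add: abs_if)
  then have "\<bar>real_of_int (3 * (i - j) - 2 ^ k)\<bar> < 1" by simp
  then have "\<bar>3 * (i - j) - 2 ^ k\<bar> < 1" by linarith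
  then have "(2 :: int) ^ k = 3 * (i - j)" by linarith
  then have "(3 :: int) dvd 2 ^ k" by simp
  then have "(3 :: int) dvd 2" using prime_dvd_power[of "3 :: int" 2 k] by simp
  then show False by simp
qed

text \<open>The corner of the dyadic cube of generation \<open>k\<close> that contains \<open>x\<close>, in closed form, for the cube
  of corner \<open>a\<close> and side \<open>L\<close>.\<close>

definition dcorner :: "real ^ 'n \<Rightarrow> real \<Rightarrow> nat \<Rightarrow> real ^ 'n \<Rightarrow> real ^ 'n" where
  "dcorner a L k x = (\<chi> i. a $ i + L / 2 ^ k * \<lfloor>(x $ i - a $ i) / (L / 2 ^ k)\<rfloor>)"

lemma dcorner_0: "0 < L \<Longrightarrow> x \<in> hcube a L \<Longrightarrow> dcorner a L 0 x = a"
proof -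
  assume L: "0 < L" and x: "x \<in> hcube a L"
  have "\<lfloor>(x $ i - a $ i) / L\<rfloor> = 0" for i
  proof -
    have "a $ i \<le> x $ i \<and> x $ i < a $ i + L" using x by (simp add: hcube_def)
    then show ?thesis using L by (simp add: floor_eq_iff field_simps)
  qed
  then show ?thesis by (simp add: dcorner_def vec_eq_iff)
qed

lemma dcorner_child: "0 < L \<Longrightarrow> dcorner (child a L T) (L / 2) k x = dcorner a L (Suc k) x"
proof -
  assume L: "0 < L"
  define H where "H = L / 2 ^ Suc k"
  have H: "L / 2 / 2 ^ k = H" "L / 2 ^ Suc k = H" "0 < H" "L / 2 = H * 2 ^ k" using L by (auto simp: H_def)
  have *: "a $ i + (if i \<in> T then L / 2 else 0) + H * \<lfloor>(x $ i - (a $ i + (if i \<in> T then L / 2 else 0))) / H\<rfloor>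
      = a $ i + H * \<lfloor>(x $ i - a $ i) / H\<rfloor>" for i
  proof (cases "i \<in> T")
    case True
    have "(x $ i - (a $ i + L / 2)) / H = (x $ i - a $ i) / H - of_int (2 ^ k)"
      unfolding H(4) using H(3) by (simp add: field_simps)
    then have "\<lfloor>(x $ i - (a $ i + L / 2)) / H\<rfloor> = \<lfloor>(x $ i - a $ i) / H\<rfloor> - 2 ^ k"
      by (simp only: floor_diff_of_int)
    then show ?thesis using True H(4) by (simp add: right_diff_distrib)
  qed simp
  then show ?thesis
    unfolding dcorner_def H child_def by (simp add: vec_eq_iff *)
qed

lemma avg_dyadic_le_dmax:
  assumes "0 < L" "x \<in> hcube a L"
  shows "avg f (cube (dcorner a L k x) (L / 2 ^ k)) \<le> dmax f k a L x"
  using assms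
proof (induction k arbitrary: a L)
  case 0
  then show ?case by (simp add: dcorner_0)
next
  case (Suc k)
  have "x \<in> hcube (child a L (upper a L x)) (L / 2)" using Suc.prems by (simp add: mem_hcube_child)
  then have "avg f (cube (dcorner (child a L (upper a L x)) (L / 2) k x) (L / 2 / 2 ^ k)) \<le> dmax f k (child a L (upper a L x)) (L / 2) x"
    using Suc.prems by (intro Suc.IH) auto
  then show ?case using Suc.prems by (simp add: dcorner_child max.coboundedI2)
qed

lemma dmax_mono: "dmax f k a L x \<le> dmax f (Suc k) a L x"
proof (induction k arbitrary: a L)
  case (Suc k)
  let ?b = "child a L (upper a L x)"
  have "dmax f (Suc k) a L x = max (avg f (cube a L)) (dmax f k ?b (L / 2) x)"
    "dmax f (Suc (Suc k)) a L x = max (avg f (cube a L)) (dmax f (Suc k) ?b (L / 2) x)"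
    by (rule dmax.simps(2))+
  then show ?case using max.mono[OF order_refl Suc.IH] by metis
qed simp

text \<open>The corners of the root cubes, which have side \<open>6 l\<close>. In every coordinate the root is
  \<open>[q - 3 l, q + 3 l]\<close> or this interval shifted by one third of its length; either way it contains
  \<open>[q - l, q + 2 l]\<close>, in which the intervals shorter than \<open>l\<close> that meet \<open>[q, q + l]\<close> lie.\<close>

definition root_corner :: "real ^ 'n \<Rightarrow> real \<Rightarrow> 'n set \<Rightarrow> real ^ 'n" where
  "root_corner q l S = (\<chi> i. q $ i - 3 * l + (if i \<in> S then 2 * l else 0))"

text \<open>Measured relative to the average over the root, so that it is unchanged when a constant is added
  to \<open>h\<close>; all generations are taken into account.\<close>

definition excess :: "(real ^ 'n \<Rightarrow> real) \<Rightarrow> real ^ 'n \<Rightarrow> real \<Rightarrow> real ^ 'n \<Rightarrow> ennreal" where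
  "excess h a L x = (SUP k. ennreal (dmax h k a L x - avg h (cube a L)))"

lemma borel_measurable_excess: "excess h a L \<in> borel_measurable borel"
  unfolding excess_def using borel_measurable_dmax[of h _ a L] by measurable

lemma integral_excess_le:
  fixes h :: "real ^ 'n \<Rightarrow> real"
  assumes h: "h \<in> L1_loc" and B: "0 < B" "\<And>a l. 0 < l \<Longrightarrow> mean_osc h (cube a l) \<le> B" and L: "0 < L"
  shows "(\<integral>\<^sup>+x\<in>hcube a L. excess h a L x \<partial>lebesgue) \<le> ennreal ((4 + 2 ^ CARD('n)) * B * L ^ CARD('n))"
proof -
  let ?p = "avg h (cube a L)"
  let ?e = "\<lambda>k x. ennreal (dmax h k a L x - ?p) * indicator (hcube a L) x"
  have "(\<integral>\<^sup>+x\<in>hcube a L. excess h a L x \<partial>lebesgue) = (\<integral>\<^sup>+x. (SUP k. ?e k x) \<partial>lebesgue)"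
    by (simp add: excess_def SUP_mult_right_ennreal)
  also have "\<dots> = (SUP k. \<integral>\<^sup>+x. ?e k x \<partial>lebesgue)"
  proof (rule nn_integral_monotone_convergence_SUP)
    show "incseq ?e"
      by (intro incseq_SucI le_funI mult_right_mono ennreal_leI diff_right_mono dmax_mono) auto
    show "?e k \<in> borel_measurable lebesgue" for k
    proof -
      have "?e k \<in> borel_measurable borel"
        using borel_measurable_dmax[of h k a L] hcube_borel[of a L] by measurable
      then show ?thesis by (intro measurable_completion) simp
    qed
  qed
  also have "\<dots> \<le> ennreal ((4 + 2 ^ CARD('n)) * B * L ^ CARD('n))"
  proof (rule SUP_least)
    fix k
    have i: "set_integrable lebesgue (hcube a L) (\<lambda>x. dmax h k a L x - ?p)"
      by (intro set_integrable_diff_const set_integrable_dmax lmeasurable_hcube)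
    have "(\<integral>\<^sup>+x. ?e k x \<partial>lebesgue) = (\<integral>\<^sup>+x. ennreal (indicator (hcube a L) x *\<^sub>R (dmax h k a L x - ?p)) \<partial>lebesgue)"
      by (intro nn_integral_cong) (auto simp: indicator_def)
    also have "\<dots> = ennreal (LINT x:hcube a L|lebesgue. dmax h k a L x - ?p)"
      unfolding set_lebesgue_integral_def
      by (rule nn_integral_eq_integral) (use i avg_le_dmax[of h a L k] in \<open>auto simp: set_integrable_def\<close>)
    also have "\<dots> \<le> ennreal ((4 + 2 ^ CARD('n)) * B * L ^ CARD('n))"
      by (intro ennreal_leI integral_dmax_le h B L)
    finally show "(\<integral>\<^sup>+x. ?e k x \<partial>lebesgue) \<le> \<dots>" .
  qed
  finally show ?thesis .
qed

text \<open>The dyadic fractions of \<open>6 l\<close> meet the interval between \<open>3 r\<close> and \<open>6 r\<close>: long enough for the one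
  third trick, short enough that the volumes are comparable.\<close>

lemma dyadic_scale:
  fixes r l :: real
  assumes "0 < r" "r < l"
  obtains k :: nat where "3 * r < 6 * l / 2 ^ k" "6 * l / 2 ^ k \<le> 6 * r"
proof -
  have ex: "\<exists>k :: nat. l / r \<le> 2 ^ k" using real_arch_pow[of 2 "l / r"] by (auto intro: less_imp_le)
  define k where "k = (LEAST k. l / r \<le> 2 ^ k)"
  have k: "l / r \<le> 2 ^ k" unfolding k_def using ex by (rule LeastI_ex)
  have "k \<noteq> 0"
  proof
    assume "k = 0"
    with k have "l / r \<le> 1" by simp
    then show False using assms by (simp add: field_simps)
  qed
  then obtain j where j: "k = Suc j" using not0_implies_Suc by blast
  have "\<not> l / r \<le> 2 ^ j" using not_less_Least[of j "\<lambda>k. l / r \<le> 2 ^ k"] j by (simp add: k_def)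
  then show ?thesis
    using k assms j by (intro that[of k]) (auto simp: field_simps)
qed

text \<open>The one third trick applied in each coordinate; the coordinates that need the shifted grid form
  the index \<open>S\<close> of the root.\<close>

lemma cube_in_shifted_dyadic:
  fixes q :: "real ^ 'n"
  assumes r: "0 < r" "r < l" and x: "x \<in> cube a r"
  shows "\<exists>S k. cube a r \<subseteq> cube (dcorner (root_corner q l S) (6 * l) k x) (6 * l / 2 ^ k) \<and> 6 * l / 2 ^ k \<le> 6 * r"
proof -
  obtain k where k: "3 * r < 6 * l / 2 ^ k" "6 * l / 2 ^ k \<le> 6 * r" by (rule dyadic_scale[OF r])
  define H where "H = 6 * l / 2 ^ k"
  have H: "0 < H" using r by (simp add: H_def)
  define T where "T i s \<longleftrightarrow> \<lfloor>(a $ i - (q $ i - 3 * l + s)) / H\<rfloor> = \<lfloor>(a $ i + r - (q $ i - 3 * l + s)) / H\<rfloor>" for i s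
  define S where "S = {i. T i (2 * l)}"
  have T: "T i (if i \<in> S then 2 * l else 0)" for i
    using floor_eq_in_shifted_grid[OF H_def, of r "a $ i" "q $ i - 3 * l"] r k
    by (auto simp: S_def T_def H_def)
  have "cube a r \<subseteq> cube (dcorner (root_corner q l S) (6 * l) k x) H"
  proof (rule cube_subset)
    fix i
    define p where "p = root_corner q l S $ i"
    define m where "m = \<lfloor>(a $ i - p) / H\<rfloor>"
    have m: "\<lfloor>(a $ i + r - p) / H\<rfloor> = m"
      using T[of i] by (simp add: T_def m_def p_def root_corner_def)
    have "a $ i \<le> x $ i \<and> x $ i \<le> a $ i + r" using x by (simp add: mem_cube)
    then have "\<lfloor>(a $ i - p) / H\<rfloor> \<le> \<lfloor>(x $ i - p) / H\<rfloor>" "\<lfloor>(x $ i - p) / H\<rfloor> \<le> \<lfloor>(a $ i + r - p) / H\<rfloor>"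
      using H by (intro floor_mono divide_right_mono; simp)+
    then have "\<lfloor>(x $ i - p) / H\<rfloor> = m" unfolding m m_def by simp
    then have D: "dcorner (root_corner q l S) (6 * l) k x $ i = p + H * m"
      by (simp add: dcorner_def H_def[symmetric] p_def[symmetric])
    have "of_int m \<le> (a $ i - p) / H" by (simp add: m_def)
    moreover have "(a $ i + r - p) / H < of_int m + 1" unfolding m[symmetric] by linarith
    ultimately show "dcorner (root_corner q l S) (6 * l) k x $ i \<le> a $ i
        \<and> a $ i + r \<le> dcorner (root_corner q l S) (6 * l) k x $ i + H"
      unfolding D using H by (simp add: field_simps)
  qed
  with k show ?thesis unfolding H_def by blast
qed

section \<open>The mean of the maximal function over a cube\<close>

lemma root_corner_component:
  assumes "0 < l"
  shows "q $ i - 3 * l \<le> root_corner q l S $ i \<and> root_corner q l S $ i \<le> q $ i - l"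
  using assms by (auto simp: root_corner_def)

lemma cube_subset_root:
  assumes "0 < l"
  shows "cube q l \<subseteq> hcube (root_corner q l S) (6 * l)"
proof
  fix x assume x: "x \<in> cube q l"
  show "x \<in> hcube (root_corner q l S) (6 * l)"
    unfolding hcube_def mem_Collect_eq
  proof
    fix i
    have "q $ i \<le> x $ i \<and> x $ i \<le> q $ i + l" using x by (simp add: mem_cube)
    then show "root_corner q l S $ i \<le> x $ i \<and> x $ i < root_corner q l S $ i + 6 * l"
      using root_corner_component[OF assms, of q i S] assms by auto
  qed
qed

lemma small_cube_subset_root:
  assumes l: "r \<le> l" "0 < l" and x: "x \<in> cube q l" "x \<in> cube a r"
  shows "cube a r \<subseteq> cube (root_corner q l S) (6 * l)"
proof (rule cube_subset)
  fix i
  have "q $ i \<le> x $ i \<and> x $ i \<le> q $ i + l" "a $ i \<le> x $ i \<and> x $ i \<le> a $ i + r"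
    using x by (simp_all add: mem_cube)
  then show "root_corner q l S $ i \<le> a $ i \<and> a $ i + r \<le> root_corner q l S $ i + 6 * l"
    using root_corner_component[OF l(2), of q i S] l by auto
qed

text \<open>Treats the competitors whose side is less than that of \<open>Q\<close>. For \<open>h\<close>, pass from the small cube to the
  comparable dyadic cube around it, and from there to the dyadic maximal function. For \<open>g\<close>, pass to the
  root directly, on which \<open>g\<close> varies by at most \<open>\<eta>\<close>.\<close>

lemma avg_small_cube_le:
  fixes g h :: "real ^ 'n \<Rightarrow> real"
  assumes g: "g \<in> L1_loc" and h: "h \<in> L1_loc"
    and B: "\<And>a l. 0 < l \<Longrightarrow> mean_osc h (cube a l) \<le> B"
    and \<eta>: "\<And>z w. (\<And>i. \<bar>z $ i - w $ i\<bar> \<le> 6 * l) \<Longrightarrow> \<bar>g z - g w\<bar> \<le> \<eta>"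
    and r: "0 < r" "r < l" and x: "x \<in> cube q l" "x \<in> cube a r"
  shows "\<exists>S k. avg (\<lambda>x. g x + h x) (cube a r)
    \<le> avg (\<lambda>x. g x + h x) (cube (root_corner q l S) (6 * l)) + \<eta> + 6 ^ CARD('n) * B
       + (dmax h k (root_corner q l S) (6 * l) x - avg h (cube (root_corner q l S) (6 * l)))"
proof -
  obtain S k where sub: "cube a r \<subseteq> cube (dcorner (root_corner q l S) (6 * l) k x) (6 * l / 2 ^ k)"
    and le: "6 * l / 2 ^ k \<le> 6 * r"
    using cube_in_shifted_dyadic[OF r x(2)] by blast
  let ?p = "root_corner q l S" let ?P = "cube ?p (6 * l)"
  let ?D = "cube (dcorner ?p (6 * l) k x) (6 * l / 2 ^ k)"
  have l: "0 < l" using r by simp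
  have add: "avg (\<lambda>x. g x + h x) (cube b m) = avg g (cube b m) + avg h (cube b m)" for b m
    using L1_loc_cube[OF g] L1_loc_cube[OF h] by (simp add: avg_def set_integral_add add_divide_distrib)
  have "\<bar>avg h (cube a r) - avg h ?D\<bar> \<le> 6 ^ CARD('n) * B"
    using l r le by (intro avg_nested_cubes h sub B) auto
  moreover have "avg h ?D \<le> dmax h k ?p (6 * l) x"
    using l cube_subset_root[OF l, of q S] x(1) by (intro avg_dyadic_le_dmax) auto
  moreover have "\<bar>avg g (cube a r) - avg g ?P\<bar> \<le> \<eta>"
  proof (rule abs_avg_le[OF L1_loc_cube[OF g] lmeasurable_cube measure_cube_pos[OF r(1)]])
    fix z assume "z \<in> cube a r"
    then have z: "z \<in> ?P" using small_cube_subset_root[of r l x q a S] r x by auto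
    have "\<bar>avg g ?P - g z\<bar> \<le> \<eta>"
    proof (rule abs_avg_le[OF L1_loc_cube[OF g] lmeasurable_cube measure_cube_pos])
      fix w assume w: "w \<in> ?P"
      show "\<bar>g w - g z\<bar> \<le> \<eta>"
      proof (rule \<eta>)
        fix i
        have "?p $ i \<le> w $ i \<and> w $ i \<le> ?p $ i + 6 * l" "?p $ i \<le> z $ i \<and> z $ i \<le> ?p $ i + 6 * l"
          using w z by (simp_all add: mem_cube)
        then show "\<bar>w $ i - z $ i\<bar> \<le> 6 * l" by (auto simp: abs_le_iff)
      qed
    qed (use l in simp)
    then show "\<bar>g z - avg g ?P\<bar> \<le> \<eta>" by (simp add: abs_minus_commute)
  qed
  ultimately have "avg (\<lambda>x. g x + h x) (cube a r) \<le> avg (\<lambda>x. g x + h x) ?P + \<eta> + 6 ^ CARD('n) * B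
       + (dmax h k ?p (6 * l) x - avg h ?P)"
    unfolding add by linarith
  then show ?thesis by blast
qed

text \<open>The sum over all roots avoids choosing the grid for \<open>x\<close> measurably.\<close>

lemma maximal_pointwise_le:
  fixes f g h :: "real ^ 'n \<Rightarrow> real"
  assumes f: "f \<in> L1_loc" and g: "continuous_on UNIV g" and h: "h \<in> L1_loc"
    and fgh: "\<And>x. \<bar>f x\<bar> = g x + h x"
    and B: "0 < B" "\<And>a l. 0 < l \<Longrightarrow> mean_osc h (cube a l) \<le> B"
    and \<eta>: "0 \<le> \<eta>" "\<And>z w. (\<And>i. \<bar>z $ i - w $ i\<bar> \<le> 6 * l) \<Longrightarrow> \<bar>g z - g w\<bar> \<le> \<eta>"
    and l: "0 < l" and x: "x \<in> cube q l" and y: "y \<in> cube q l"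
  shows "maximal f x \<le> maximal f y + ennreal (\<eta> + 2 * 6 ^ CARD('n) * B)
     + (\<Sum>S\<in>UNIV. excess h (root_corner q l S) (6 * l) x)"
proof (rule maximal_leI[OF f])
  fix a :: "real ^ 'n" and r :: real assume r: "0 < r" and xr: "x \<in> cube a r"
  let ?F = "\<lambda>x. \<bar>f x\<bar>" and ?K = "\<eta> + 2 * 6 ^ CARD('n) * B"
  have K: "0 \<le> ?K" using \<eta>(1) B(1) by simp
  have p: "(2 :: real) ^ CARD('n) \<le> 6 ^ CARD('n)" by (rule power_mono) auto
  have q: "\<bar>y $ i - x $ i\<bar> \<le> l" for i
  proof -
    have "q $ i \<le> x $ i \<and> x $ i \<le> q $ i + l" "q $ i \<le> y $ i \<and> y $ i \<le> q $ i + l"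
      using x y by (simp_all add: mem_cube)
    then show ?thesis by (auto simp: abs_le_iff)
  qed
  show "ennreal (avg ?F (cube a r)) \<le> maximal f y + ennreal ?K
     + (\<Sum>S\<in>UNIV. excess h (root_corner q l S) (6 * l) x)"
  proof (cases "l \<le> r")
    case True
    have "avg (\<lambda>x. g x + h x) (cube a r) \<le> avg (\<lambda>x. g x + h x) (cube (a + (y - x)) r) + \<eta> + 2 * 2 ^ CARD('n) * B"
    proof (rule avg_shift_le[OF g h B(2) _ r])
      show "\<bar>g (y - x + z) - g z\<bar> \<le> \<eta>" for z
      proof (rule \<eta>(2))
        fix i show "\<bar>(y - x + z) $ i - z $ i\<bar> \<le> 6 * l" using q[of i] l by simp
      qed
      show "\<bar>(y - x) $ i\<bar> \<le> r" for i using q[of i] True by simp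
    qed
    also have "\<dots> \<le> avg (\<lambda>x. g x + h x) (cube (a + (y - x)) r) + ?K"
      using p B(1) by simp
    finally have "avg ?F (cube a r) \<le> avg ?F (cube (a + (y - x)) r) + ?K"
      by (simp add: fgh)
    then have "ennreal (avg ?F (cube a r)) \<le> ennreal (avg ?F (cube (a + (y - x)) r)) + ennreal ?K"
      using K by (simp add: ennreal_plus[symmetric] avg_nonneg ennreal_leI del: ennreal_plus)
    also have "ennreal (avg ?F (cube (a + (y - x)) r)) \<le> maximal f y"
      using xr by (intro avg_le_maximal f r) (simp add: mem_cube algebra_simps)
    finally show ?thesis by (meson add_increasing2 add_right_mono order_trans zero_le)
  next
    case False
    have "\<exists>S k. avg (\<lambda>x. g x + h x) (cube a r)
      \<le> avg (\<lambda>x. g x + h x) (cube (root_corner q l S) (6 * l)) + \<eta> + 6 ^ CARD('n) * B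
       + (dmax h k (root_corner q l S) (6 * l) x - avg h (cube (root_corner q l S) (6 * l)))"
    proof (rule avg_small_cube_le[OF L1_loc_continuous[OF g] h])
      show "r < l" using False by simp
      show "\<bar>g z - g w\<bar> \<le> \<eta>" if "\<And>i. \<bar>z $ i - w $ i\<bar> \<le> 6 * l" for z w using that by (rule \<eta>(2))
    qed (use B(2) r x xr in auto)
    then obtain S k where Sk: "avg (\<lambda>x. g x + h x) (cube a r)
      \<le> avg (\<lambda>x. g x + h x) (cube (root_corner q l S) (6 * l)) + \<eta> + 6 ^ CARD('n) * B
       + (dmax h k (root_corner q l S) (6 * l) x - avg h (cube (root_corner q l S) (6 * l)))"
      by blast
    let ?P = "cube (root_corner q l S) (6 * l)"
    let ?E = "dmax h k (root_corner q l S) (6 * l) x - avg h ?P"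
    have E: "0 \<le> ?E" using avg_le_dmax[of h "root_corner q l S" "6 * l" k x] by simp
    have "avg ?F (cube a r) \<le> avg ?F ?P + ?K + ?E"
    proof -
      have "0 \<le> 6 ^ CARD('n) * B" using B(1) by simp
      with Sk show ?thesis unfolding fgh[symmetric] by linarith
    qed
    then have "ennreal (avg ?F (cube a r)) \<le> ennreal (avg ?F ?P) + ennreal ?K + ennreal ?E"
      using K E by (simp add: ennreal_plus[symmetric] avg_nonneg ennreal_leI del: ennreal_plus)
    also have "ennreal (avg ?F ?P) \<le> maximal f y"
      using l cube_subset_root[OF l, of q S] hcube_subset_cube[of "root_corner q l S" "6 * l"] y
      by (intro avg_le_maximal f) auto
    also have "ennreal ?E \<le> excess h (root_corner q l S) (6 * l) x"
      unfolding excess_def by (rule SUP_upper) simp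
    also have "excess h (root_corner q l S) (6 * l) x \<le> (\<Sum>S\<in>UNIV. excess h (root_corner q l S) (6 * l) x)"
      by (rule member_le_sum) auto
    finally show ?thesis by (simp add: add_mono)
  qed
qed

text \<open>The first summand comes from the pointwise comparison. The second is the number of roots, times
  the constant of \<open>integral_dmax_le\<close>, times the ratio of the volume of a root to that of \<open>Q\<close>.\<close>

definition osc_const :: "'n::finite itself \<Rightarrow> real" where
  "osc_const _ = 2 * 6 ^ CARD('n) + 2 ^ CARD('n) * (4 + 2 ^ CARD('n)) * 6 ^ CARD('n)"

lemma osc_const_pos: "0 < osc_const TYPE('n::finite)"
  by (simp add: osc_const_def add_pos_pos)

lemma integral_maximal_le:
  fixes f g h :: "real ^ 'n \<Rightarrow> real"
  assumes f: "f \<in> L1_loc" and g: "continuous_on UNIV g" and h: "h \<in> L1_loc"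
    and fgh: "\<And>x. \<bar>f x\<bar> = g x + h x"
    and B: "0 < B" "\<And>a l. 0 < l \<Longrightarrow> mean_osc h (cube a l) \<le> B"
    and \<eta>: "0 \<le> \<eta>" "\<And>z w. (\<And>i. \<bar>z $ i - w $ i\<bar> \<le> 6 * l) \<Longrightarrow> \<bar>g z - g w\<bar> \<le> \<eta>"
    and l: "0 < l" and y: "y \<in> cube q l"
  shows "(\<integral>\<^sup>+x\<in>cube q l. maximal f x \<partial>lebesgue)
    \<le> ennreal (l ^ CARD('n)) * (maximal f y + ennreal (\<eta> + osc_const TYPE('n) * B))"
proof -
  let ?n = "CARD('n)"
  let ?K = "\<eta> + 2 * 6 ^ ?n * B" and ?p = "root_corner q l"
  let ?E = "\<lambda>S x. excess h (?p S) (6 * l) x"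
  have K: "0 \<le> ?K" using \<eta>(1) B(1) by simp
  have Em: "?E S \<in> borel_measurable lebesgue" for S
    using borel_measurable_excess[of h "?p S" "6 * l"] by (intro measurable_completion) simp
  have im: "indicator (cube q l) \<in> borel_measurable lebesgue" "indicator (hcube a m) \<in> borel_measurable lebesgue" for a m
    by (rule borel_measurable_indicator, simp)+
  have "(\<integral>\<^sup>+x\<in>cube q l. maximal f x \<partial>lebesgue)
      \<le> (\<integral>\<^sup>+x. (maximal f y + ennreal ?K) * indicator (cube q l) x + (\<Sum>S\<in>UNIV. ?E S x * indicator (hcube (?p S) (6 * l)) x) \<partial>lebesgue)"
  proof (intro nn_integral_mono)
    fix x
    show "maximal f x * indicator (cube q l) x
      \<le> (maximal f y + ennreal ?K) * indicator (cube q l) x + (\<Sum>S\<in>UNIV. ?E S x * indicator (hcube (?p S) (6 * l)) x)"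
    proof (cases "x \<in> cube q l")
      case True
      then have "(\<Sum>S\<in>UNIV. ?E S x * indicator (hcube (?p S) (6 * l)) x) = (\<Sum>S\<in>UNIV. ?E S x)"
        using cube_subset_root[OF l, of q] by (intro sum.cong refl) (auto simp: indicator_def)
      then show ?thesis using True maximal_pointwise_le[OF f g h fgh B \<eta> l True y] by simp
    qed simp
  qed
  also have "\<dots> = (maximal f y + ennreal ?K) * emeasure lebesgue (cube q l)
      + (\<Sum>S\<in>UNIV. \<integral>\<^sup>+x\<in>hcube (?p S) (6 * l). ?E S x \<partial>lebesgue)"
  proof -
    have m: "(\<lambda>x. ?E S x * indicator (hcube (?p S) (6 * l)) x) \<in> borel_measurable lebesgue" for S
      by (intro borel_measurable_times_ennreal Em im)
    have c: "(\<lambda>x. (maximal f y + ennreal ?K) * indicator (cube q l) x) \<in> borel_measurable lebesgue"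
      by (rule borel_measurable_times_ennreal[OF borel_measurable_const im(1)])
    show ?thesis
      unfolding nn_integral_add[OF c borel_measurable_sum[OF m]] nn_integral_sum[OF m]
        nn_integral_cmult_indicator[OF cube_sets] ..
  qed
  also have "(\<Sum>S\<in>UNIV. \<integral>\<^sup>+x\<in>hcube (?p S) (6 * l). ?E S x \<partial>lebesgue)
     \<le> (\<Sum>S\<in>(UNIV :: 'n set set). ennreal ((4 + 2 ^ ?n) * B * (6 * l) ^ ?n))"
    using l by (intro sum_mono integral_excess_le h B) auto
  also have "\<dots> = ennreal (2 ^ ?n * ((4 + 2 ^ ?n) * B * (6 * l) ^ ?n))"
    using l B(1) by (subst sum_ennreal) (auto simp: card_UNIV_set)
  also have "2 ^ ?n * ((4 + 2 ^ ?n) * B * (6 * l) ^ ?n) = l ^ ?n * (2 ^ ?n * (4 + 2 ^ ?n) * 6 ^ ?n * B)"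
    by (simp add: power_mult_distrib mult_ac)
  also have "(maximal f y + ennreal ?K) * emeasure lebesgue (cube q l) + ennreal (l ^ ?n * (2 ^ ?n * (4 + 2 ^ ?n) * 6 ^ ?n * B))
    = ennreal (l ^ ?n) * (maximal f y + (ennreal ?K + ennreal (2 ^ ?n * (4 + 2 ^ ?n) * 6 ^ ?n * B)))"
    unfolding emeasure_cube[OF less_imp_le[OF l]]
    using l B(1) by (simp add: ennreal_mult distrib_left mult_ac add_ac)
  also have "ennreal ?K + ennreal (2 ^ ?n * (4 + 2 ^ ?n) * 6 ^ ?n * B) = ennreal (\<eta> + osc_const TYPE('n) * B)"
    using K B(1) by (subst ennreal_plus[symmetric]) (auto simp: osc_const_def algebra_simps)
  finally show ?thesis by (simp add: add_mono)
qed

section \<open>Oscillation of the maximal function\<close>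

lemma uniformly_continuous_componentwise:
  fixes g :: "real ^ 'n \<Rightarrow> real"
  assumes "uniformly_continuous_on UNIV g" "0 < e"
  shows "\<exists>d>0. \<forall>x y. (\<forall>i. \<bar>x $ i - y $ i\<bar> \<le> d) \<longrightarrow> \<bar>g x - g y\<bar> \<le> e"
proof -
  obtain d where d: "0 < d" "\<And>x y. dist x y < d \<Longrightarrow> dist (g x) (g y) < e"
    using assms unfolding uniformly_continuous_on_def by (metis UNIV_I)
  let ?d = "d / (2 * CARD('n))"
  have "\<bar>g x - g y\<bar> \<le> e" if "\<forall>i. \<bar>x $ i - y $ i\<bar> \<le> ?d" for x y
  proof -
    have "dist x y \<le> (\<Sum>i\<in>UNIV. \<bar>(x - y) $ i\<bar>)"
      unfolding dist_norm by (rule norm_le_l1_cart)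
    also have "\<dots> \<le> (\<Sum>i\<in>(UNIV :: 'n set). ?d)" using that by (intro sum_mono) simp
    also have "\<dots> < d" using d by simp
    finally have "dist (g x) (g y) < e" by (rule d)
    then show ?thesis by (simp add: dist_real_def)
  qed
  then show ?thesis using d by (intro exI[of _ ?d]) auto
qed

text \<open>The easy direction of Sarason's theorem.\<close>

lemma VMO_small_osc:
  fixes f :: "real ^ 'n \<Rightarrow> real"
  assumes f: "f \<in> VMO" and e: "0 < e"
  shows "\<exists>d>0. \<forall>a l. 0 < l \<longrightarrow> l \<le> d \<longrightarrow> mean_osc f (cube a l) \<le> e"
proof -
  obtain g where g: "g \<in> BMO" "uniformly_continuous_on UNIV g" "bmo_norm (\<lambda>x. f x - g x) < ennreal (e / 2)"
    using f half_gt_zero[OF e] unfolding VMO_def by blast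
  have f1: "f \<in> L1_loc" and g1: "g \<in> L1_loc" using f g by (auto simp: VMO_def BMO_def)
  obtain d where d: "0 < d" "\<And>x y. (\<forall>i. \<bar>x $ i - y $ i\<bar> \<le> d) \<Longrightarrow> \<bar>g x - g y\<bar> \<le> e / 4"
    using uniformly_continuous_componentwise[OF g(2), of "e / 4"] e by auto
  have "mean_osc f (cube a l) \<le> e" if l: "0 < l" "l \<le> d" for a l
  proof -
    have G: "(\<lambda>x. 0 - g x) \<in> L1_loc" by (intro L1_loc_diff g1) (simp add: L1_loc_def set_integrable_def)
    have "mean_osc (\<lambda>x. 0 - g x) (cube a l) \<le> 2 * (e / 4)"
    proof (rule mean_osc_le_const[OF L1_loc_cube[OF G] lmeasurable_cube measure_cube_pos[OF l(1)]])
      fix x assume x: "x \<in> cube a l"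
      have "\<bar>a $ i - x $ i\<bar> \<le> d" for i using mem_cube_D[OF x, of i] l by (auto simp: abs_le_iff)
      then have "\<bar>g a - g x\<bar> \<le> e / 4" using d by blast
      then show "\<bar>0 - g x - (- g a)\<bar> \<le> e / 4" by simp
    qed
    moreover have "mean_osc (\<lambda>x. f x - g x) (cube a l) \<le> e / 2"
      using g(3) e l bmo_norm_le_iff[of "e / 2" "\<lambda>x. f x - g x"] by (simp add: less_imp_le)
    moreover have "mean_osc (\<lambda>x. (f x - g x) - (0 - g x)) (cube a l)
        \<le> mean_osc (\<lambda>x. f x - g x) (cube a l) + mean_osc (\<lambda>x. 0 - g x) (cube a l)"
      by (intro mean_osc_diff_le L1_loc_cube L1_loc_diff f1 g1 G lmeasurable_cube)
    ultimately show ?thesis by simp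
  qed
  then show ?thesis using d by blast
qed

lemma BMO_abs:
  fixes f :: "real ^ 'n \<Rightarrow> real"
  assumes f: "f \<in> BMO"
  shows "(\<lambda>x. \<bar>f x\<bar>) \<in> BMO"
proof -
  have f1: "f \<in> L1_loc" using f by (simp add: BMO_def)
  obtain B where B: "0 < B" "\<And>a l. 0 < l \<Longrightarrow> mean_osc f (cube a l) \<le> B" using BMO_bound[OF f] by auto
  have "mean_osc (\<lambda>x. \<bar>f x\<bar>) (cube a l) \<le> 2 * B" if "0 < l" for a l
    using mean_osc_abs_le[OF L1_loc_cube[OF f1] lmeasurable_cube measure_cube_pos[OF that], of a] B(2)[OF that, of a]
    by linarith
  then show ?thesis using B(1) by (intro BMO_I[of _ "2 * B"] L1_loc_abs f1) auto
qed

text \<open>Taking absolute values does not preserve smallness of a difference in \<open>BMO\<close>, so it cannot be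
  applied to the approximations of \<open>f\<close>; the criterion through oscillations on small cubes is used
  instead.\<close>

lemma VMO_abs:
  fixes f :: "real ^ 'n \<Rightarrow> real"
  assumes f: "f \<in> VMO"
  shows "(\<lambda>x. \<bar>f x\<bar>) \<in> VMO"
proof (rule VMO_I)
  have fb: "f \<in> BMO" using f by (simp add: VMO_def)
  then show "(\<lambda>x. \<bar>f x\<bar>) \<in> BMO" by (rule BMO_abs)
  have f1: "f \<in> L1_loc" using fb by (simp add: BMO_def)
  fix e :: real assume e: "0 < e"
  obtain d where d: "0 < d" "\<And>a l. 0 < l \<Longrightarrow> l \<le> d \<Longrightarrow> mean_osc f (cube a l) \<le> e / 2"
    using VMO_small_osc[OF f, of "e / 2"] e by auto
  have "mean_osc (\<lambda>x. \<bar>f x\<bar>) (cube a l) \<le> e" if "0 < l" "l \<le> d" for a l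
    using mean_osc_abs_le[OF L1_loc_cube[OF f1] lmeasurable_cube measure_cube_pos[OF that(1)], of a] d(2)[OF that, of a]
    by linarith
  then show "\<exists>d>0. \<forall>a l. 0 < l \<longrightarrow> l \<le> d \<longrightarrow> mean_osc (\<lambda>x. \<bar>f x\<bar>) (cube a l) \<le> e"
    using d(1) by blast
qed

text \<open>Finiteness at a single point of a cube suffices, since every point may be taken as \<open>y\<close> in the
  bound for the mean.\<close>

lemma integral_maximal_finite:
  fixes f :: "real ^ 'n \<Rightarrow> real"
  assumes f: "f \<in> BMO" and l: "0 < l" and y: "y \<in> cube q l" "maximal f y < \<infinity>"
  shows "(\<integral>\<^sup>+x\<in>cube q l. maximal f x \<partial>lebesgue) < \<infinity>"
proof -
  have fa: "(\<lambda>x. \<bar>f x\<bar>) \<in> BMO" by (rule BMO_abs[OF f])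
  then have h: "(\<lambda>x. \<bar>f x\<bar>) \<in> L1_loc" by (simp add: BMO_def)
  obtain B where B: "0 < B" "\<And>a l. 0 < l \<Longrightarrow> mean_osc (\<lambda>x. \<bar>f x\<bar>) (cube a l) \<le> B"
    using BMO_bound[OF fa] by auto
  have "(\<integral>\<^sup>+x\<in>cube q l. maximal f x \<partial>lebesgue)
    \<le> ennreal (l ^ CARD('n)) * (maximal f y + ennreal (0 + osc_const TYPE('n) * B))"
    by (rule integral_maximal_le[where g = "\<lambda>_. 0" and h = "\<lambda>x. \<bar>f x\<bar>"])
       (use f h B l y in \<open>auto simp: BMO_def\<close>)
  also have "\<dots> < \<infinity>" using y(2) by (simp add: ennreal_mult_less_top)
  finally show ?thesis .
qed

lemma lebesgue_measurable_maximal: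
  assumes "f \<in> L1_loc"
  shows "maximal f \<in> borel_measurable lebesgue"
  using borel_measurable_maximal[OF assms] by (intro measurable_completion) simp

lemma cube_about_UN: "(\<Union>m. ccube x (real (Suc m))) = UNIV"
proof -
  have "\<exists>m. z \<in> ccube x (real (Suc m))" for z
  proof -
    obtain m :: nat where "infnorm (z - x) \<le> real m" using real_arch_simple by blast
    then show ?thesis by (intro exI[of _ m]) (simp add: mem_ccube)
  qed
  then show ?thesis by auto
qed

lemma AE_maximal_finite:
  fixes f :: "real ^ 'n \<Rightarrow> real"
  assumes f: "f \<in> BMO" and y: "maximal f y < \<infinity>"
  shows "AE x in lebesgue. maximal f x < \<infinity>"
proof -
  have f1: "f \<in> L1_loc" using f by (simp add: BMO_def)
  have "AE x in lebesgue. x \<in> ccube y (real (Suc m)) \<longrightarrow> maximal f x < \<infinity>" for m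
  proof -
    let ?Q = "ccube y (real (Suc m))"
    have "y \<in> ?Q" by (simp add: mem_ccube infnorm_0)
    then have "(\<integral>\<^sup>+x\<in>?Q. maximal f x \<partial>lebesgue) < \<infinity>"
      unfolding ccube_def by (intro integral_maximal_finite f) (use y in auto)
    moreover have "(\<lambda>x. maximal f x * indicator ?Q x) \<in> borel_measurable lebesgue"
      by (intro borel_measurable_times_ennreal lebesgue_measurable_maximal f1 borel_measurable_indicator) (simp add: ccube_def)
    ultimately have "AE x in lebesgue. maximal f x * indicator ?Q x \<noteq> \<infinity>"
      by (intro nn_integral_noteq_infinite) auto
    then show ?thesis by eventually_elim (auto simp: less_top indicator_def)
  qed
  then have "AE x in lebesgue. \<forall>m. x \<in> ccube y (real (Suc m)) \<longrightarrow> maximal f x < \<infinity>"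
    unfolding AE_all_countable by blast
  then show ?thesis
    by eventually_elim (use cube_about_UN[of y] in blast)
qed

lemma L1_loc_maximal:
  fixes f :: "real ^ 'n \<Rightarrow> real"
  assumes f: "f \<in> BMO" and y: "maximal f y < \<infinity>"
  shows "(\<lambda>x. enn2real (maximal f x)) \<in> L1_loc"
  unfolding L1_loc_def mem_Collect_eq
proof (intro allI impI)
  fix K :: "(real ^ 'n) set" assume K: "compact K"
  have f1: "f \<in> L1_loc" using f by (simp add: BMO_def)
  have um: "(\<lambda>x. enn2real (maximal f x)) \<in> borel_measurable lebesgue"
    by (intro borel_measurable_enn2real lebesgue_measurable_maximal f1)
  obtain r where r: "\<And>x. x \<in> K \<Longrightarrow> dist y x \<le> r"
    using compact_imp_bounded[OF K] unfolding bounded_any_center[of _ y] by blast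
  let ?Q = "ccube y (max 1 r)"
  have sub: "K \<subseteq> ?Q"
  proof
    fix x assume "x \<in> K"
    then have "infnorm (x - y) \<le> r" using r[of x] infnorm_le_norm[of "x - y"] by (simp add: dist_norm norm_minus_commute)
    then show "x \<in> ?Q" by (simp add: mem_ccube)
  qed
  have Q: "?Q \<in> sets lebesgue" by (simp add: ccube_def)
  have "set_integrable lebesgue ?Q (\<lambda>x. enn2real (maximal f x))"
    unfolding set_integrable_def
  proof (rule integrableI_nonneg)
    have "(\<integral>\<^sup>+x. ennreal (indicator ?Q x *\<^sub>R enn2real (maximal f x)) \<partial>lebesgue) \<le> (\<integral>\<^sup>+x\<in>?Q. maximal f x \<partial>lebesgue)"
      by (intro nn_integral_mono) (auto simp: indicator_def ennreal_enn2real_if)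
    also have "\<dots> < \<infinity>"
      unfolding ccube_def
      by (rule integral_maximal_finite[OF f _ _ y]) (use mem_ccube[of y y "max 1 r"] in \<open>auto simp: ccube_def infnorm_0\<close>)
    finally show "(\<integral>\<^sup>+x. ennreal (indicator ?Q x *\<^sub>R enn2real (maximal f x)) \<partial>lebesgue) < \<infinity>" .
  qed (use um Q in \<open>auto intro!: borel_measurable_times borel_measurable_indicator\<close>)
  then show "set_integrable lebesgue K (\<lambda>x. enn2real (maximal f x))"
    by (rule set_integrable_subset) (use sub K in \<open>auto intro: lmeasurable_compact fmeasurableD\<close>)
qed

text \<open>Choose \<open>y\<close> at which \<open>M f\<close> is within \<open>C\<close> of its infimum \<open>m\<close> over the cube. Then \<open>M f\<close> is at least
  \<open>M f y - C\<close> on the cube, while its mean is at most \<open>M f y + C\<close>; so its mean deviation from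
  \<open>M f y - C\<close> is at most \<open>2 C\<close>.\<close>

lemma mean_osc_maximal_le:
  fixes f :: "real ^ 'n \<Rightarrow> real"
  assumes f: "f \<in> BMO" and z: "maximal f z < \<infinity>" and l: "0 < l" and C: "0 < C"
    and bound: "\<And>y. y \<in> cube q l \<Longrightarrow>
      (\<integral>\<^sup>+x\<in>cube q l. maximal f x \<partial>lebesgue) \<le> ennreal (l ^ CARD('n)) * (maximal f y + ennreal C)"
  shows "mean_osc (\<lambda>x. enn2real (maximal f x)) (cube q l) \<le> 4 * C"
proof -
  let ?Q = "cube q l" and ?u = "\<lambda>x. enn2real (maximal f x)"
  have ae: "AE x in lebesgue. maximal f x < \<infinity>" by (rule AE_maximal_finite[OF f z])
  have u: "set_integrable lebesgue ?Q ?u" by (rule L1_loc_cube[OF L1_loc_maximal[OF f z]])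
  define m where "m = (INF y\<in>?Q. maximal f y)"
  have "\<exists>y\<in>?Q. maximal f y < \<infinity>"
  proof (rule ccontr)
    assume "\<not> ?thesis"
    with ae have "AE x in lebesgue. x \<notin> ?Q" by (auto elim: eventually_mono)
    then have "emeasure lebesgue ?Q = 0"
      by (subst (asm) AE_iff_measurable[of ?Q]) auto
    then show False using l by (simp only: emeasure_cube[OF less_imp_le[OF l]]) simp
  qed
  then have mfin: "m < \<infinity>" unfolding m_def by (meson INF_lower le_less_trans)
  then obtain r where r: "0 \<le> r" "m = ennreal r" by (cases m) auto
  have "m < m + ennreal C"
    unfolding r(2) using r(1) C by (simp add: ennreal_plus[symmetric] ennreal_less_iff del: ennreal_plus)
  then obtain y where y: "y \<in> ?Q" "maximal f y < m + ennreal C" unfolding m_def INF_less_iff by blast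
  have "m + ennreal C < \<infinity>" using mfin by simp
  then have yfin: "maximal f y < \<infinity>" using y(2) by (rule less_trans[rotated])
  have low: "?u y - C \<le> ?u x" if x: "x \<in> ?Q" "maximal f x < \<infinity>" for x
  proof -
    have "maximal f y \<le> maximal f x + ennreal C"
      using y(2) INF_lower[OF x(1), of "maximal f"] unfolding m_def by (meson add_right_mono less_imp_le order_trans)
    then have "enn2real (maximal f y) \<le> enn2real (maximal f x + ennreal C)"
      using x(2) by (intro enn2real_mono) auto
    also have "\<dots> = ?u x + C" using x(2) C by (subst enn2real_plus) auto
    finally show ?thesis by simp
  qed
  have "ennreal (LINT x:?Q|lebesgue. ?u x) = (\<integral>\<^sup>+x. ennreal (indicator ?Q x *\<^sub>R ?u x) \<partial>lebesgue)"
    unfolding set_lebesgue_integral_def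
    by (rule nn_integral_eq_integral[symmetric]) (use u in \<open>auto simp: set_integrable_def\<close>)
  also have "\<dots> \<le> (\<integral>\<^sup>+x\<in>?Q. maximal f x \<partial>lebesgue)"
    by (intro nn_integral_mono) (auto simp: indicator_def ennreal_enn2real_if)
  also have "\<dots> \<le> ennreal (l ^ CARD('n)) * (maximal f y + ennreal C)" by (rule bound[OF y(1)])
  also have "maximal f y = ennreal (?u y)" using yfin by (simp add: less_top)
  also have "ennreal (l ^ CARD('n)) * (ennreal (?u y) + ennreal C) = ennreal (l ^ CARD('n) * (?u y + C))"
    using l C by (simp add: ennreal_mult ennreal_plus[symmetric] del: ennreal_plus)
  finally have up: "(LINT x:?Q|lebesgue. ?u x) \<le> l ^ CARD('n) * (?u y + C)"
    using l C by (subst (asm) ennreal_le_iff) auto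
  let ?c = "?u y - C"
  have "(LINT x:?Q|lebesgue. \<bar>?u x - ?c\<bar>) = (LINT x:?Q|lebesgue. ?u x - ?c)"
  proof (rule set_lebesgue_integral_cong_AE)
    show "AE x\<in>?Q in lebesgue. \<bar>?u x - ?c\<bar> = ?u x - ?c"
      using ae by eventually_elim (use low in fastforce)
    have "?u \<in> borel_measurable lebesgue"
      using f by (intro borel_measurable_enn2real lebesgue_measurable_maximal) (simp add: BMO_def)
    then show "(\<lambda>x. \<bar>?u x - ?c\<bar>) \<in> borel_measurable lebesgue" "(\<lambda>x. ?u x - ?c) \<in> borel_measurable lebesgue"
      by (auto intro!: borel_measurable_abs borel_measurable_diff)
  qed simp
  also have "\<dots> = (LINT x:?Q|lebesgue. ?u x) - ?c * l ^ CARD('n)"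
    using l by (simp add: set_integral_diff u lmeasurable_integrable_const lmeasurable_integral_const measure_cube left_diff_distrib)
  also have "\<dots> \<le> l ^ CARD('n) * (?u y + C) - ?c * l ^ CARD('n)" using up by simp
  also have "\<dots> = 2 * C * l ^ CARD('n)" by (simp add: algebra_simps)
  finally have "2 * (LINT x:?Q|lebesgue. \<bar>?u x - ?c\<bar>) / measure lebesgue ?Q \<le> 4 * C"
    using l by (simp add: measure_cube field_simps)
  then show ?thesis
    using mean_osc_le[OF u lmeasurable_cube measure_cube_pos[OF l], of ?c] by linarith
qed

theorem theorem3p1:
  fixes f :: "real ^ 'n \<Rightarrow> real"
  assumes "f \<in> VMO"
    and "\<exists>x. maximal f x \<noteq> \<infinity>"
  shows "(AE x in lebesgue. maximal f x < \<infinity>) \<and> (\<lambda>x. enn2real (maximal f x)) \<in> VMO"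
proof
  obtain z where z: "maximal f z < \<infinity>" using assms(2) by (auto simp: less_top)
  have fb: "f \<in> BMO" using assms(1) by (simp add: VMO_def)
  have f1: "f \<in> L1_loc" using fb by (simp add: BMO_def)
  have fv: "(\<lambda>x. \<bar>f x\<bar>) \<in> VMO" by (rule VMO_abs[OF assms(1)])
  have fa: "(\<lambda>x. \<bar>f x\<bar>) \<in> BMO" "(\<lambda>x. \<bar>f x\<bar>) \<in> L1_loc" using fv by (auto simp: VMO_def BMO_def)
  let ?u = "\<lambda>x. enn2real (maximal f x)" and ?K = "osc_const TYPE('n)"
  have K: "0 < ?K" by (rule osc_const_pos)
  show "AE x in lebesgue. maximal f x < \<infinity>" by (rule AE_maximal_finite[OF fb z])
  show "?u \<in> VMO"
  proof (rule VMO_I)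
    obtain B where B: "0 < B" "\<And>a l. 0 < l \<Longrightarrow> mean_osc (\<lambda>x. \<bar>f x\<bar>) (cube a l) \<le> B"
      using BMO_bound[OF fa(1)] by auto
    have "mean_osc ?u (cube q l) \<le> 4 * (0 + ?K * B)" if l: "0 < l" for q l
    proof (rule mean_osc_maximal_le[OF fb z l])
      show "(\<integral>\<^sup>+x\<in>cube q l. maximal f x \<partial>lebesgue) \<le> ennreal (l ^ CARD('n)) * (maximal f y + ennreal (0 + ?K * B))"
        if "y \<in> cube q l" for y
        by (rule integral_maximal_le[where g = "\<lambda>_. 0" and h = "\<lambda>x. \<bar>f x\<bar>"])
           (use f1 fa B l that in auto)
    qed (use K B in simp)
    then show "?u \<in> BMO"
      using K B by (intro BMO_I[OF L1_loc_maximal[OF fb z], of "4 * (0 + ?K * B)"]) auto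
  next
    fix e :: real assume e: "0 < e"
    \<comment> \<open>The same number \<open>B\<close> bounds the oscillation of \<open>h\<close> and the variation of \<open>g\<close>.\<close>
    define B where "B = e / (4 * (1 + ?K))"
    have B: "0 < B" using e K by (simp add: B_def)
    have "4 * (B + ?K * B) = 4 * (1 + ?K) * B" by (simp add: algebra_simps)
    also have "\<dots> = e" using K by (simp add: B_def)
    finally have Be: "4 * (B + ?K * B) = e" .
    obtain g where g: "g \<in> BMO" "uniformly_continuous_on UNIV g" "bmo_norm (\<lambda>x. \<bar>f x\<bar> - g x) < ennreal B"
      using fv B unfolding VMO_def by blast
    have g1: "g \<in> L1_loc" using g by (simp add: BMO_def)
    have h: "mean_osc (\<lambda>x. \<bar>f x\<bar> - g x) (cube a l) \<le> B" if "0 < l" for a l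
      using g(3) B that bmo_norm_le_iff[of B "\<lambda>x. \<bar>f x\<bar> - g x"] by (simp add: less_imp_le)
    obtain d where d: "0 < d" "\<And>x y. (\<forall>i. \<bar>x $ i - y $ i\<bar> \<le> d) \<Longrightarrow> \<bar>g x - g y\<bar> \<le> B"
      using uniformly_continuous_componentwise[OF g(2) B] by auto
    have "mean_osc ?u (cube q l) \<le> 4 * (B + ?K * B)" if l: "0 < l" "l \<le> d / 6" for q l
    proof (rule mean_osc_maximal_le[OF fb z l(1)])
      show "(\<integral>\<^sup>+x\<in>cube q l. maximal f x \<partial>lebesgue) \<le> ennreal (l ^ CARD('n)) * (maximal f y + ennreal (B + ?K * B))"
        if y: "y \<in> cube q l" for y
      proof (rule integral_maximal_le[where g = g and h = "\<lambda>x. \<bar>f x\<bar> - g x"])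
        show "\<bar>g z - g w\<bar> \<le> B" if "\<And>i. \<bar>z $ i - w $ i\<bar> \<le> 6 * l" for z w
        proof (intro d(2) allI)
          fix i show "\<bar>z $ i - w $ i\<bar> \<le> d" using that[of i] l by linarith
        qed
      qed (use f1 fa g1 h B l y uniformly_continuous_imp_continuous[OF g(2)] in \<open>auto intro: L1_loc_diff\<close>)
    qed (use K B in \<open>simp add: add_pos_pos\<close>)
    then show "\<exists>d>0. \<forall>a l. 0 < l \<longrightarrow> l \<le> d \<longrightarrow> mean_osc ?u (cube a l) \<le> e"
      using d(1) Be by (intro exI[of _ "d / 6"]) auto
  qed
qed

end
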